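(* There exists $\epsilon>0$ such that for every $$h_1(x)=\|x\|^2(a_0x_0+a_1x_1+a_2x_2+a_3x_3)\in\|x\|^2\mathcal{H}_1,\qquad a_0,\dots,a_3\in\mathbb{R},$$ with $\|h_1\|_{L^2}^2=48(a_0^2+a_1^2+a_2^2+a_3^2)=1$, and for every $g\in W\setminus\Delta^{\mathbb{C}}$ with $\|g-h_1\|_{L^2}\le\epsilon$, the zero set $Z(g)\subset\mathbb{R}\mathrm{P}^3$ contains exactly $3$ real projective lines.
   Context: $W=\mathbb{R}[x_0,\ldots,x_3]_{(3)}$ is the space of real homogeneous polynomials of degree $3$ in $x=(x_0,\ldots,x_3)$; $\mathcal{H}_1$ is the space of real linear forms in $x_0,\ldots,x_3$ and $\|x\|^2=x_0^2+x_1^2+x_2^2+x_3^2$. The norm $\|\cdot\|_{L^2}$ on $W$ is the one induced by the scalar product $$(f,g)_{L^2}=\frac{1}{4\pi^2}\int_{\mathbb{R}^4}f(x)g(x)e^{-\|x\|^2/2}\,dx .$$ $\Delta^{\mathbb{C}}\subset W$ (the complex discriminant) is the set consisting of the zero polynomial and of all nonzero $g\in W$ that have a complex singularity, i.e. whose partial derivatives $\partial g/\partial x_0,\ldots,\partial g/\partial x_3$ have a common zero in $\mathbb{C}\mathrm{P}^3$. For $g\in W$, $Z(g)\subset\mathbb{R}\mathrm{P}^3$ is the real projective zero set. *)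

theory Defs
  imports "HOL-Analysis.Analysis" "HOL-Library.Poly_Mapping"
begin

text \<open>
  A polynomial in the variables \<open>x\<^sub>i\<close>, \<open>i :: 'n\<close>, is a finitely supported map from
  exponent vectors to coefficients. The ring operations are those of \<^theory>\<open>HOL-Library.Poly_Mapping\<close>
  (the product is the convolution product). With \<open>'n = 4\<close> the variables are
  \<open>x\<^sub>0, x\<^sub>1, x\<^sub>2, x\<^sub>3\<close>.
\<close>

type_synonym 'n rpoly = "('n \<Rightarrow>\<^sub>0 nat) \<Rightarrow>\<^sub>0 real"

definition X :: "'n \<Rightarrow> 'n rpoly" where
  "X i = Poly_Mapping.single (Poly_Mapping.single i 1) 1"

definition const :: "real \<Rightarrow> 'n rpoly" where
  "const c = Poly_Mapping.single 0 c"

definition eval :: "'n::finite rpoly \<Rightarrow> 'a::real_field ^ 'n \<Rightarrow> 'a" where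
  "eval p x =
     (\<Sum>m\<in>Poly_Mapping.keys p.
        of_real (Poly_Mapping.lookup p m) * (\<Prod>i\<in>UNIV. (x $ i) ^ Poly_Mapping.lookup m i))"

text \<open>
  The subtraction of exponents is truncated, but the coefficient vanishes whenever \<open>x\<^sub>i\<close>
  does not occur in the monomial.
\<close>

definition partial_deriv :: "'n \<Rightarrow> 'n::finite rpoly \<Rightarrow> 'n rpoly" where
  "partial_deriv i p =
     (\<Sum>m\<in>Poly_Mapping.keys p.
        Poly_Mapping.single (m - Poly_Mapping.single i 1)
          (of_nat (Poly_Mapping.lookup m i) * Poly_Mapping.lookup p m))"

definition forms :: "nat \<Rightarrow> 'n::finite rpoly set" where
  "forms d = {p. \<forall>m\<in>Poly_Mapping.keys p. (\<Sum>i\<in>UNIV. Poly_Mapping.lookup m i) = d}"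

abbreviation W :: "4 rpoly set" where
  "W \<equiv> forms 3"

definition inner_L2 :: "4 rpoly \<Rightarrow> 4 rpoly \<Rightarrow> real" where
  "inner_L2 f g =
     1 / (4 * pi\<^sup>2) *
     (\<integral>x. eval f x * eval g x * exp (- (norm x)\<^sup>2 / 2) \<partial>(lborel :: (real ^ 4) measure))"

definition norm_L2 :: "4 rpoly \<Rightarrow> real" where
  "norm_L2 f = sqrt (inner_L2 f f)"

text \<open>
  Points of the projective space of \<open>K\<^sup>n\<close> are the one-dimensional \<open>K\<close>-linear subspaces. A projective
  line is the set of all points lying in a given two-dimensional subspace.
\<close>

definition proj_space :: "('a::field ^ 'n::finite) set set" where
  "proj_space = {P. vec.subspace P \<and> vec.dim P = 1}"

definition proj_lines :: "('a::field ^ 'n::finite) set set set" where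
  "proj_lines = {{P \<in> proj_space. P \<subseteq> V} | V. vec.subspace V \<and> vec.dim V = 2}"

definition proj_zeros :: "'n::finite rpoly set \<Rightarrow> ('a::real_field ^ 'n) set set" where
  "proj_zeros F = {P \<in> proj_space. \<forall>p\<in>F. \<forall>x\<in>P. eval p x = 0}"

abbreviation Z :: "4 rpoly \<Rightarrow> (real ^ 4) set set" where
  "Z g \<equiv> proj_zeros {g}"

definition complex_discriminant :: "4 rpoly set" where
  "complex_discriminant =
     {0} \<union> {g \<in> W. g \<noteq> 0 \<and>
             (proj_zeros {partial_deriv i g | i. True} :: (complex ^ 4) set set) \<noteq> {}}"

definition h1 :: "real ^ 4 \<Rightarrow> 4 rpoly" where
  "h1 a = (\<Sum>i\<in>UNIV. (X i)\<^sup>2) * (\<Sum>i\<in>UNIV. const (a $ i) * X i)"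

end

theory Submission
  imports Defs "HOL-Probability.Distributions"
begin

text \<open>
  The cubic \<open>g\<close> is the diagonal of a symmetric trilinear form \<open>T\<close>. For \<open>g\<close> near
  \<open>\<parallel>x\<parallel>\<^sup>2 (a \<bullet> x)\<close> the quadratic form \<open>T x x a\<close> is positive definite, so \<open>g\<close> is strictly
  increasing in the direction \<open>a\<close> and its real zero set is a graph over \<open>\<real>P\<^sup>2\<close>. Hence any two real
  lines on it meet; by smoothness two of them determine a third one in the plane they span, and
  there are no others.

  One line exists because the obstruction, a complex function on frames that is multiplied by
  \<open>\<i>\<close> under a quarter turn, has odd winding number along a loop whose double is contractible in
  \<open>SO(3)\<close>. For a second line, consider the residual conics in the pencil of planes through the
  first line. On that line they form a pencil of binary quadratic forms with a definite member,
  hence simultaneously diagonalisable; between the two degenerate members of this pencil the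
  determinant of the residual conic changes sign, and where it vanishes the conic is a pair of
  real lines.

  The \<open>L\<^sup>2\<close> norm bounds the coefficients of a cubic form, because these are its scalar products
  with Hermite polynomials up to positive factors; this makes the neighbourhood uniform in \<open>a\<close>.
\<close>

section \<open>Lines on real cubic surfaces\<close>

locale trilinear_form =
  fixes T :: "'a::euclidean_space \<Rightarrow> 'a \<Rightarrow> 'a \<Rightarrow> real"
  assumes swap12: "T x y z = T y x z"
    and swap23: "T x y z = T x z y"
    and add1: "T (x + x') y z = T x y z + T x' y z"
    and scale1: "T (c *\<^sub>R x) y z = c * T x y z"
begin

lemma add2: "T x (y + y') z = T x y z + T x y' z"
  by (metis swap12 add1)

lemma add3: "T x y (z + z') = T x y z + T x y z'"
  by (metis swap23 add2)

lemma scale2: "T x (c *\<^sub>R y) z = c * T x y z"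
  by (metis swap12 scale1)

lemma scale3: "T x y (c *\<^sub>R z) = c * T x y z"
  by (metis swap23 scale2)

lemma zero1 [simp]: "T 0 y z = 0"
  using scale1[of 0 0 y z] by simp

lemma zero2 [simp]: "T x 0 z = 0"
  using scale2[of x 0 0 z] by simp

lemma zero3 [simp]: "T x y 0 = 0"
  using scale3[of x y 0 0] by simp

lemma minus1: "T (- x) y z = - T x y z"
  using scale1[of "-1" x y z] by simp

lemma minus2: "T x (- y) z = - T x y z"
  using scale2[of x "-1" y z] by simp

lemma minus3: "T x y (- z) = - T x y z"
  using scale3[of x y "-1" z] by simp

lemma diff1: "T (x - x') y z = T x y z - T x' y z"
  using add1[of x "- x'" y z] by (simp add: minus1)

lemma diff2: "T x (y - y') z = T x y z - T x y' z"
  using add2[of x y "- y'" z] by (simp add: minus2)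

lemma diff3: "T x y (z - z') = T x y z - T x y z'"
  using add3[of x y z "- z'"] by (simp add: minus3)

lemmas expand = add1 add2 add3 scale1 scale2 scale3 minus1 minus2 minus3 diff1 diff2 diff3

lemmas swaps = swap12 swap23

lemma linear3: "linear (T x y)"
  by (rule linearI) (simp_all add: expand)

lemma span_zero: "x \<in> span S \<Longrightarrow> (\<And>s. s \<in> S \<Longrightarrow> T p q s = 0) \<Longrightarrow> T p q x = 0"
  using linear_eq_0_on_span[OF linear3] by blast

text \<open>Written out in coordinates with respect to \<open>Basis\<close>, a trilinear form is a
  polynomial in the coordinates of its arguments.\<close>

lemma continuous_on_cube [continuous_intros]:
  fixes h :: "'b::topological_space \<Rightarrow> 'a"
  assumes "continuous_on S h"
  shows "continuous_on S (\<lambda>x. T (h x) (h x) (h x))"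
proof -
  have 1: "T x y z = (\<Sum>i\<in>Basis. (x \<bullet> i) * T i y z)" for x y z
  proof -
    have lin: "linear (\<lambda>x. T x y z)"
      by (rule linearI) (simp_all add: expand)
    have "T x y z = T (\<Sum>i\<in>Basis. (x \<bullet> i) *\<^sub>R i) y z"
      by (simp add: euclidean_representation)
    also have "\<dots> = (\<Sum>i\<in>Basis. (x \<bullet> i) * T i y z)"
      by (simp add: linear_sum[OF lin] scale1)
    finally show ?thesis .
  qed
  have 2: "T x y z = (\<Sum>i\<in>Basis. (x \<bullet> i) * (\<Sum>j\<in>Basis. (y \<bullet> j) * (\<Sum>k\<in>Basis. (z \<bullet> k) * T i j k)))"
    for x y z
  proof -
    have 3: "T i j z = (\<Sum>k\<in>Basis. (z \<bullet> k) * T i j k)" for i j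
    proof -
      have perm: "T i j w = T w i j" for w
        by (metis swap12 swap23)
      show ?thesis
        unfolding perm by (rule 1)
    qed
    have 4: "T i y z = (\<Sum>j\<in>Basis. (y \<bullet> j) * T i j z)" for i
      using 1[of y i z] by (simp only: swap12[of _ i])
    have "T x y z = (\<Sum>i\<in>Basis. (x \<bullet> i) * (\<Sum>j\<in>Basis. (y \<bullet> j) * T i j z))"
      by (subst 1) (simp only: 4)
    then show ?thesis
      unfolding 3 .
  qed
  have "continuous_on S (\<lambda>x. \<Sum>i\<in>Basis. (h x \<bullet> i) *
      (\<Sum>j\<in>Basis. (h x \<bullet> j) * (\<Sum>k\<in>Basis. (h x \<bullet> k) * T i j k)))"
    by (intro continuous_intros assms)
  moreover have "(\<lambda>x. T (h x) (h x) (h x)) = (\<lambda>x. \<Sum>i\<in>Basis. (h x \<bullet> i) *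
      (\<Sum>j\<in>Basis. (h x \<bullet> j) * (\<Sum>k\<in>Basis. (h x \<bullet> k) * T i j k)))"
    by (rule ext, rule 2)
  ultimately show ?thesis
    by (rule ssubst[rotated])
qed

text \<open>Projective lines on the surface, encoded as two-dimensional subspaces of the ambient
  vector space.\<close>

definition zero_planes :: "'a set set" where
  "zero_planes = {V. subspace V \<and> dim V = 2 \<and> (\<forall>x\<in>V. T x x x = 0)}"

text \<open>Polarisation recovers the trilinear form from its values on the diagonal.\<close>

lemma zero_planes_trilinear:
  assumes "V \<in> zero_planes" "x \<in> V" "y \<in> V" "z \<in> V"
  shows "T x y z = 0"
proof -
  have V: "subspace V" "\<And>x. x \<in> V \<Longrightarrow> T x x x = 0"
    using assms(1) by (auto simp: zero_planes_def)
  have "6 * T x y z = T (x+y+z) (x+y+z) (x+y+z) - T (x+y) (x+y) (x+y) - T (x+z) (x+z) (x+z)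
      - T (y+z) (y+z) (y+z) + T x x x + T y y y + T z z z"
    by (simp add: expand swaps)
  also have "\<dots> = 0"
    using assms(2-4) V by (simp add: subspace_add)
  finally show ?thesis by simp
qed

text \<open>Up to factors 3, the four values are the coefficients of the binary cubic obtained by
  restriction to the span.\<close>

lemma span2_in_zero_planes:
  assumes "independent {u, v}" "u \<noteq> v"
    "T u u u = 0" "T u u v = 0" "T u v v = 0" "T v v v = 0"
  shows "span {u, v} \<in> zero_planes"
proof -
  have "dim (span {u, v}) = 2"
    using assms(1,2) by (simp add: dim_eq_card_independent)
  moreover have "T x x x = 0" if "x \<in> span {u, v}" for x
  proof -
    obtain s t where x: "x = s *\<^sub>R u + t *\<^sub>R v"
      using \<open>x \<in> span {u, v}\<close> by (auto simp: span_breakdown_eq algebra_simps)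
    show ?thesis
      using assms(3-6) unfolding x by (simp add: expand swaps)
  qed
  ultimately show ?thesis
    by (simp add: zero_planes_def)
qed

end

section \<open>Bases of planes; smooth cubics that increase along a direction\<close>

lemma independent2_iff:
  fixes u v :: "'a::real_vector"
  shows "independent {u, v} \<and> u \<noteq> v \<longleftrightarrow> v \<noteq> 0 \<and> u \<notin> span {v}"
  by (auto simp: independent_insert span_base)

lemma subspace_dim2_basis:
  fixes V :: "'a::euclidean_space set"
  assumes "subspace V" "dim V = 2"
  obtains u v where "independent {u, v}" "u \<noteq> v" "V = span {u, v}"
proof -
  obtain B where B: "B \<subseteq> V" "independent B" "V \<subseteq> span B" "card B = dim V"
    using basis_exists by blast
  then obtain u v where uv: "B = {u, v}" "u \<noteq> v"
    using assms(2) by (metis card_2_iff)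
  have "V = span {u, v}"
    using B uv assms(1) by (metis span_minimal subset_antisym)
  then show ?thesis
    using that B uv by metis
qed

lemma subspace_dim2_basis_containing:
  fixes V :: "'a::euclidean_space set"
  assumes "subspace V" "dim V = 2" "p \<in> V" "p \<noteq> 0"
  obtains u where "u \<in> V" "u \<notin> span {p}" "V = span {p, u}"
proof -
  have "\<not> V \<subseteq> span {p}"
    using dim_subset[of V "span {p}"] assms by auto
  then obtain u where u: "u \<in> V" "u \<notin> span {p}" by blast
  have i: "independent {p, u}" "p \<noteq> u"
    using u assms(4) independent2_iff[of u p] by (auto simp: insert_commute)
  have "span {p, u} = V"
    by (rule subspace_dim_equal)
       (use u i assms span_minimal[of "{p, u}" V] in \<open>auto simp: dim_eq_card_independent\<close>)
  then show ?thesis using that u by metis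
qed

text \<open>\<open>3 * T x x a\<close> is the derivative of the cubic at \<open>x\<close> in the
  direction \<open>a\<close>. In \<open>nonsingular\<close> the two conditions are the vanishing of
  the real and imaginary parts of \<open>T z z y\<close> at \<open>z = p + i q\<close>, so it says
  that there is no complex singular point.\<close>

locale cubic_surface = trilinear_form +
  fixes a :: 'a
  assumes dim4: "DIM('a) = 4"
    and pos: "x \<noteq> 0 \<Longrightarrow> T x x a > 0"
    and nonsingular: "(\<And>y. T p p y = T q q y) \<Longrightarrow> (\<And>y. T p q y = 0) \<Longrightarrow> p = 0 \<and> q = 0"
begin

lemma a_nonzero: "a \<noteq> 0"
proof
  assume a: "a = 0"
  obtain b :: 'a where "b \<in> Basis" using nonempty_Basis by blast
  then have "b \<noteq> 0" by auto
  then show False using pos[of b] a by simp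
qed

text \<open>The difference is the integral of the derivative
  \<open>3 * T (x + s *\<^sub>R a) (x + s *\<^sub>R a) a\<close> over \<open>s\<close> from 0 to
  \<open>t\<close>. Expanding around the midpoint removes the linear term and leaves two summands
  whose signs are known.\<close>

lemma cube_shift:
  "T (x + t *\<^sub>R a) (x + t *\<^sub>R a) (x + t *\<^sub>R a) - T x x x
    = t * (3 * T (x + (t/2) *\<^sub>R a) (x + (t/2) *\<^sub>R a) a + t\<^sup>2 / 4 * T a a a)"
  by (simp add: expand swaps algebra_simps power2_eq_square)

lemma cube_strict_mono:
  assumes "s < t"
  shows "T (x + s *\<^sub>R a) (x + s *\<^sub>R a) (x + s *\<^sub>R a) < T (x + t *\<^sub>R a) (x + t *\<^sub>R a) (x + t *\<^sub>R a)"
proof -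
  let ?x = "x + s *\<^sub>R a" and ?d = "t - s"
  have e: "?x + ?d *\<^sub>R a = x + t *\<^sub>R a"
    by (simp add: algebra_simps)
  have "T (?x + (?d/2) *\<^sub>R a) (?x + (?d/2) *\<^sub>R a) a \<ge> 0"
    using pos by (metis less_eq_real_def zero1)
  moreover have "?d\<^sup>2 / 4 * T a a a > 0"
    using assms pos[OF a_nonzero] by simp
  ultimately have "?d * (3 * T (?x + (?d/2) *\<^sub>R a) (?x + (?d/2) *\<^sub>R a) a + ?d\<^sup>2 / 4 * T a a a) > 0"
    using assms by simp
  then show ?thesis
    using cube_shift[of ?x ?d] unfolding e by linarith
qed

lemma cube_shift_eq:
  assumes "T x x x = 0" "T y y y = 0" "x = y + t *\<^sub>R a"
  shows "t = 0"
  using cube_strict_mono[of 0 t y] cube_strict_mono[of t 0 y] assms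
  by (cases t "0::real" rule: linorder_cases) auto

lemma full_span:
  fixes u v y z :: 'a
  assumes "independent {u, v, y}" "card {u, v, y} = 3" "z \<notin> span {u, v, y}"
  shows "span {z, u, v, y} = UNIV"
proof -
  have n: "z \<notin> {u, v, y}" using assms(3) span_base[of z "{u, v, y}"] by blast
  have "independent {z, u, v, y}"
    using assms(1,3) n by (simp add: independent_insert)
  moreover have "card {z, u, v, y} = 4"
    using assms(2) n by simp
  ultimately show ?thesis
    using dim_eq_full[of "{z, u, v, y}"] dim4 by (simp add: dim_eq_card_independent)
qed

lemma independent3:
  assumes "independent {u, v}" "u \<noteq> v" "y \<notin> span {u, v}"
  shows "independent {u, v, y}" "card {u, v, y} = 3"
proof -
  have n: "y \<notin> {u, v}" using assms(3) span_base[of y "{u, v}"] by blast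
  have "independent {y, u, v}"
    using assms(1,3) n by (simp add: independent_insert)
  moreover have "{y, u, v} = {u, v, y}" by auto
  ultimately show "independent {u, v, y}" by simp
  show "card {u, v, y} = 3" using n assms(2) by auto
qed

text \<open>Gram-Schmidt for the positive definite form \<open>T _ _ a\<close>, with the second
  vector rescaled to the length of the first. The complex vectors \<open>u + i v'\<close> and
  \<open>u - i v'\<close> are then isotropic for this form.\<close>

lemma orthogonal_basis:
  assumes "independent {u, v}" "u \<noteq> v"
  obtains v' where "v' \<in> span {u, v}" "T u u a = T v' v' a" "T u v' a = 0" "u \<noteq> 0" "v' \<noteq> 0"
    "span {u, v'} = span {u, v}" "independent {u, v'}" "u \<noteq> v'"
proof -
  have u: "u \<noteq> 0" "v \<notin> span {u}"
    using assms independent2_iff[of v u] by (auto simp: insert_commute)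
  define m where "m = T u v a / T u u a"
  define v1 where "v1 = v - m *\<^sub>R u"
  have pu: "T u u a > 0" using pos u by simp
  have v1: "v1 \<noteq> 0"
    using u(2) unfolding v1_def by (auto simp: span_breakdown_eq)
  then have p1: "T v1 v1 a > 0" using pos by simp
  have o: "T u v1 a = 0"
    using pu by (simp add: v1_def m_def expand)
  define k where "k = sqrt (T u u a / T v1 v1 a)"
  have k: "k > 0" "k * k = T u u a / T v1 v1 a"
    using pu p1 by (simp_all add: k_def)
  define v' where "v' = k *\<^sub>R v1"
  have e: "T v' v' a = T u u a"
    using k p1 by (simp add: v'_def expand mult.assoc[symmetric])
  have o': "T u v' a = 0" by (simp add: v'_def expand o)
  have m1: "v' \<in> span {u, v}"
    unfolding v'_def v1_def by (intro span_mul span_diff span_base) auto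
  have "v = (1/k) *\<^sub>R v' + m *\<^sub>R u" using k by (simp add: v'_def v1_def)
  moreover have "(1/k) *\<^sub>R v' + m *\<^sub>R u \<in> span {u, v'}"
    by (intro span_add span_mul span_base) auto
  ultimately have m2: "v \<in> span {u, v'}" by simp
  have sp: "span {u, v'} = span {u, v}"
  proof
    show "span {u, v'} \<subseteq> span {u, v}"
      using m1 by (intro span_minimal) (simp_all add: span_base)
    show "span {u, v} \<subseteq> span {u, v'}"
      using m2 by (intro span_minimal) (simp_all add: span_base)
  qed
  have nz: "v' \<noteq> 0" using k v1 by (simp add: v'_def)
  have "u \<noteq> v'" using o' pu by auto
  moreover have "v' \<notin> span {u}"
  proof
    assume "v' \<in> span {u}"
    then have "span {u, v'} = span {u}"
      using span_redundant[of v' "{u}"] by (simp add: insert_commute)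
    then show False
      using u(2) m2 by simp
  qed
  ultimately have "independent {u, v'}"
    using u independent2_iff[of v' u] by (auto simp: insert_commute)
  then show ?thesis
    using that[OF m1 e[symmetric] o' u(1) nz sp] \<open>u \<noteq> v'\<close> by blast
qed

text \<open>If a plane through \<open>V\<close> were tangent along \<open>V\<close>, the two points of \<open>V\<close> where the
  positive definite form \<open>T _ _ a\<close> vanishes would be (complex conjugate) singular points.\<close>
lemma no_tangent_plane:
  assumes V: "V \<in> zero_planes" and y: "y \<notin> V" and t: "\<And>v w. v \<in> V \<Longrightarrow> w \<in> V \<Longrightarrow> T v w y = 0"
  shows False
proof -
  obtain u v0 where uv0: "independent {u, v0}" "u \<noteq> v0" "V = span {u, v0}"
    using V subspace_dim2_basis unfolding zero_planes_def by blast
  obtain v where v: "T u u a = T v v a" "T u v a = 0" "u \<noteq> 0"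
    "V = span {u, v}" "independent {u, v}" "u \<noteq> v"
    using orthogonal_basis[OF uv0(1,2)] uv0(3) by metis
  have uV: "u \<in> V" and vV: "v \<in> V"
    using v(4) by (auto intro: span_base)
  have i: "independent {u, v, y}" "card {u, v, y} = 3"
    using independent3[OF v(5,6)] y v(4) by auto
  have van: "T p q x = 0" if "p \<in> V" "q \<in> V" "x \<in> span {u, v, y}" for p q x
    using span_zero[OF that(3), of p q] zero_planes_trilinear[OF V that(1,2)] t[OF that(1,2)] uV vV
    by auto
  have "a \<notin> span {u, v, y}"
    using van[OF uV uV] pos[OF v(3)] by fastforce
  then have full: "span {a, u, v, y} = UNIV"
    using full_span i by blast
  have orth: "T u v x = 0" for x
  proof (rule span_zero[of x "{a, u, v, y}"])
    show "x \<in> span {a, u, v, y}" using full by simp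
    show "T u v s = 0" if "s \<in> {a, u, v, y}" for s
      using that v(2) van[OF uV vV] by (auto intro: span_base)
  qed
  have eq: "T u u x = T v v x" for x
  proof (rule linear_eq_on[OF linear3 linear3, of x "{a, u, v, y}"])
    show "x \<in> span {a, u, v, y}" using full by simp
    show "T u u s = T v v s" if "s \<in> {a, u, v, y}" for s
      using that v(1) van[OF uV uV, of s] van[OF vV vV, of s] by (auto simp: span_base)
  qed
  show False
    using nonsingular[OF eq orth] v(3) by simp
qed

text \<open>Two planes with trivial intersection would span the whole space, so that
  \<open>a = x + y\<close> with \<open>x\<close> in one and \<open>y\<close> in the other. Then
  \<open>x\<close> and \<open>- y\<close> would be two zeros of the cubic on one line of direction
  \<open>a\<close>.\<close>

lemma zero_planes_meet:
  assumes "V \<in> zero_planes" "V' \<in> zero_planes"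
  obtains p where "p \<in> V" "p \<in> V'" "p \<noteq> 0"
proof (rule ccontr)
  assume "\<not> thesis"
  then have z: "V \<inter> V' \<subseteq> {0}" using that by blast
  have s: "subspace V" "subspace V'" "dim V = 2" "dim V' = 2"
    using assms by (auto simp: zero_planes_def)
  have "dim {x + y |x y. x \<in> V \<and> y \<in> V'} + dim (V \<inter> V') = 4"
    using dim_sums_Int[OF s(1,2)] s by simp
  moreover have "dim (V \<inter> V') = 0" using z dim_eq_0 by blast
  ultimately have "dim {x + y |x y. x \<in> V \<and> y \<in> V'} = DIM('a)"
    unfolding dim4 by linarith
  then have "span {x + y |x y. x \<in> V \<and> y \<in> V'} = UNIV"
    unfolding dim_eq_full .
  then have "a \<in> {x + y |x y. x \<in> V \<and> y \<in> V'}"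
    unfolding span_eq_iff[THEN iffD2, OF subspace_sums[OF s(1,2)]] by simp
  then obtain x y where xy: "a = x + y" "x \<in> V" "y \<in> V'" by blast
  have "x = - y + 1 *\<^sub>R a" using xy by simp
  moreover have "T x x x = 0" "T (- y) (- y) (- y) = 0"
    using xy zero_planes_trilinear[OF assms(1)] zero_planes_trilinear[OF assms(2)]
    by (simp_all add: minus1 minus2 minus3)
  ultimately show False
    using cube_shift_eq[of x "- y" 1] by simp
qed

end

lemma span2_eq:
  fixes x y :: "'a::real_vector"
  shows "span {x, y} = {s *\<^sub>R x + t *\<^sub>R y | s t. True}"
proof
  show "span {x, y} \<subseteq> {s *\<^sub>R x + t *\<^sub>R y | s t. True}"
    by (auto simp: span_breakdown_eq algebra_simps)
  show "{s *\<^sub>R x + t *\<^sub>R y | s t. True} \<subseteq> span {x, y}"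
    by (auto intro!: span_add span_scale simp: span_base)
qed

section \<open>Two lines determine a third, and there are no others\<close>

context cubic_surface
begin

lemma zero_planes_eqI:
  assumes "V \<in> zero_planes" "V' \<in> zero_planes" "V \<subseteq> V'"
  shows "V = V'"
  using assms subspace_dim_equal[of V V'] by (simp add: zero_planes_def)

lemma zero_planes_subspace: "V \<in> zero_planes \<Longrightarrow> subspace V"
  by (simp add: zero_planes_def)

text \<open>The two planes share a vector \<open>p\<close> and span a three-dimensional space, on
  which the cubic is a product of three linear forms. The third factor cuts out the third plane
  \<open>K\<close>. A further plane is forced into \<open>K\<close>, whether or not it contains
  \<open>p\<close>.\<close>

lemma zero_planes_eq_three:
  assumes V1: "V1 \<in> zero_planes" and V2: "V2 \<in> zero_planes" and ne: "V1 \<noteq> V2"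
  obtains V3 where "V3 \<noteq> V1" "V3 \<noteq> V2" "zero_planes = {V1, V2, V3}"
proof -
  obtain p where p: "p \<in> V1" "p \<in> V2" "p \<noteq> 0"
    using zero_planes_meet[OF V1 V2] .
  obtain u where u: "u \<in> V1" "u \<notin> span {p}" "V1 = span {p, u}"
    using subspace_dim2_basis_containing V1 p unfolding zero_planes_def by blast
  obtain v where v: "v \<in> V2" "v \<notin> span {p}" "V2 = span {p, v}"
    using subspace_dim2_basis_containing V2 p unfolding zero_planes_def by blast
  have s1: "subspace V1" and s2: "subspace V2"
    using V1 V2 zero_planes_subspace by auto
  have vV1: "v \<notin> V1"
  proof
    assume "v \<in> V1"
    then have "V2 \<subseteq> V1" unfolding v(3) using p(1) s1 by (intro span_minimal) auto
    then show False using zero_planes_eqI[OF V2 V1] ne by simp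
  qed
  have uV2: "u \<notin> V2"
  proof
    assume "u \<in> V2"
    then have "V1 \<subseteq> V2" unfolding u(3) using p(2) s2 by (intro span_minimal) auto
    then show False using zero_planes_eqI[OF V1 V2] ne by simp
  qed
  note z1 = zero_planes_trilinear[OF V1] and z2 = zero_planes_trilinear[OF V2]
  have z: "T p p p = 0" "T p p u = 0" "T p u u = 0" "T u u u = 0"
    "T p p v = 0" "T p v v = 0" "T v v v = 0"
    using z1 z2 p u(1) v(1) by simp_all
  define L where "L r s t = r *\<^sub>R p + s *\<^sub>R u + t *\<^sub>R v" for r s t
  have L0: "r = 0 \<and> s = 0 \<and> t = 0" if "L r s t = 0" for r s t
  proof -
    have t: "t = 0"
    proof (rule ccontr)
      assume t: "t \<noteq> 0"
      have "v = (1/t) *\<^sub>R (t *\<^sub>R v)" using t by simp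
      also have "t *\<^sub>R v = - (r *\<^sub>R p + s *\<^sub>R u)"
        using that unfolding L_def by (metis add_eq_0_iff2 add.commute)
      finally have "v = (1/t) *\<^sub>R (- (r *\<^sub>R p + s *\<^sub>R u))" .
      moreover have "(1/t) *\<^sub>R (- (r *\<^sub>R p + s *\<^sub>R u)) \<in> V1"
        using s1 p(1) u(1) by (intro subspace_scale subspace_neg subspace_add) auto
      ultimately show False using vV1 by simp
    qed
    have s: "s = 0"
    proof (rule ccontr)
      assume s: "s \<noteq> 0"
      have "u = (1/s) *\<^sub>R (s *\<^sub>R u)" using s by simp
      also have "s *\<^sub>R u = - (r *\<^sub>R p)"
        using that t unfolding L_def by (simp add: add_eq_0_iff)
      finally have "u = (1/s) *\<^sub>R (- (r *\<^sub>R p))" .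
      moreover have "(1/s) *\<^sub>R (- (r *\<^sub>R p)) \<in> span {p}"
        by (intro span_scale span_neg span_base) auto
      ultimately show False using u(2) by simp
    qed
    show ?thesis using that s t p(3) by (simp add: L_def)
  qed
  have Linj: "r = r' \<and> s = s' \<and> t = t'" if "L r s t = L r' s' t'" for r s t r' s' t'
    using L0[of "r - r'" "s - s'" "t - t'"] that by (simp add: L_def algebra_simps)
  define c0 c1 c2 where "c0 = 2 * T p u v" and "c1 = T u u v" and "c2 = T u v v"
  have cube: "T (L r s t) (L r s t) (L r s t) = 3 * s * t * (c0 * r + c1 * s + c2 * t)" for r s t
    using z unfolding L_def c0_def c1_def c2_def
    by (simp add: expand swaps algebra_simps)
  \<comment> \<open>If both vanished, \<open>K\<close> would contain \<open>V1\<close> and the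
    three-dimensional space would be tangent along \<open>V1\<close>.\<close>
  have n1: "c0 \<noteq> 0 \<or> c1 \<noteq> 0"
  proof (rule ccontr)
    assume "\<not> ?thesis"
    then have c: "T p u v = 0" "T u u v = 0" by (auto simp: c0_def c1_def)
    show False
    proof (rule no_tangent_plane[OF V1 vV1])
      fix x y assume "x \<in> V1" "y \<in> V1"
      then obtain r s r' s' where "x = r *\<^sub>R p + s *\<^sub>R u" "y = r' *\<^sub>R p + s' *\<^sub>R u"
        unfolding u(3) by (auto simp: span_breakdown_eq algebra_simps)
      then show "T x y v = 0"
        using c z by (simp add: expand swaps)
    qed
  qed
  have n2: "c0 \<noteq> 0 \<or> c2 \<noteq> 0"
  proof (rule ccontr)
    assume "\<not> ?thesis"
    then have c: "T p u v = 0" "T u v v = 0" by (auto simp: c0_def c2_def)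
    show False
    proof (rule no_tangent_plane[OF V2 uV2])
      fix x y assume "x \<in> V2" "y \<in> V2"
      then obtain r s r' s' where "x = r *\<^sub>R p + s *\<^sub>R v" "y = r' *\<^sub>R p + s' *\<^sub>R v"
        unfolding v(3) by (auto simp: span_breakdown_eq algebra_simps)
      then show "T x y u = 0"
        using c z by (simp add: expand swaps)
    qed
  qed
  define K where "K = {L r s t | r s t. c0 * r + c1 * s + c2 * t = 0}"
  have KI: "c0 * r + c1 * s + c2 * t = 0 \<Longrightarrow> L r s t \<in> K" for r s t
    unfolding K_def by blast
  have KD: "c0 * r + c1 * s + c2 * t = 0" if "L r s t \<in> K" for r s t
    using that Linj unfolding K_def by blast
  \<comment> \<open>\<open>K\<close> is the kernel of a nonzero linear form. For
    \<open>c0 \<noteq> 0\<close> the equation is solved for \<open>r\<close>; otherwise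
    \<open>K\<close> contains \<open>p\<close> and all three planes pass through it.\<close>
  have "\<exists>x y. K = span {x, y} \<and> independent {x, y} \<and> x \<noteq> y"
  proof (cases "c0 = 0")
    case False
    let ?x = "L (- c1 / c0) 1 0" and ?y = "L (- c2 / c0) 0 1"
    have L2: "s *\<^sub>R ?x + t *\<^sub>R ?y = L (- (c1 * s + c2 * t) / c0) s t" for s t
      by (simp add: L_def algebra_simps add_divide_distrib diff_divide_distrib)
    have "K = {s *\<^sub>R ?x + t *\<^sub>R ?y | s t. True}"
    proof -
      have "c0 * r + c1 * s + c2 * t = 0 \<longleftrightarrow> r = - (c1 * s + c2 * t) / c0" for r s t
        using False by (simp add: field_simps) linarith
      then show ?thesis unfolding K_def L2 by auto
    qed
    then have "K = span {?x, ?y}"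
      unfolding span2_eq .
    moreover have "?y \<noteq> 0" using L0 by fastforce
    moreover have "?x \<notin> span {?y}"
    proof
      assume "?x \<in> span {?y}"
      then obtain k where "?x = k *\<^sub>R ?y" by (auto simp: span_singleton)
      then have "1 *\<^sub>R ?x + (-k) *\<^sub>R ?y = 0" by simp
      then have "L (- (c1 * 1 + c2 * (-k)) / c0) 1 (-k) = 0" unfolding L2 .
      then show False using L0 by fastforce
    qed
    ultimately show ?thesis using independent2_iff by blast
  next
    case True
    then have c: "c1 \<noteq> 0" "c2 \<noteq> 0" using n1 n2 by auto
    let ?x = "L 1 0 0" and ?y = "L 0 c2 (- c1)"
    have L2: "r *\<^sub>R ?x + k *\<^sub>R ?y = L r (c2 * k) (- c1 * k)" for r k
      by (simp add: L_def algebra_simps)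
    have "K = {s *\<^sub>R ?x + t *\<^sub>R ?y | s t. True}"
    proof -
      have "c1 * s + c2 * t = 0 \<longleftrightarrow> (\<exists>k. s = c2 * k \<and> t = - c1 * k)" for s t
      proof
        assume "c1 * s + c2 * t = 0"
        then have "s = c2 * (- t / c1) \<and> t = - c1 * (- t / c1)"
          using c by (simp add: field_simps)
        then show "\<exists>k. s = c2 * k \<and> t = - c1 * k" by blast
      qed auto
      then show ?thesis unfolding K_def L2 using True by auto
    qed
    then have "K = span {?x, ?y}"
      unfolding span2_eq .
    moreover have "?y \<noteq> 0" using L0 c by fastforce
    moreover have "?x \<notin> span {?y}"
    proof
      assume "?x \<in> span {?y}"
      then obtain k where "?x = k *\<^sub>R ?y" by (auto simp: span_singleton)
      then have "1 *\<^sub>R ?x + (-k) *\<^sub>R ?y = 0" by simp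
      then have "L 1 (c2 * (-k)) (- c1 * (-k)) = 0" unfolding L2 .
      then show False using L0 by fastforce
    qed
    ultimately show ?thesis using independent2_iff by blast
  qed
  then obtain x y where xy: "K = span {x, y}" "independent {x, y}" "x \<noteq> y" by blast
  have K: "K \<in> zero_planes"
  proof -
    have "dim K = 2" unfolding xy(1) using xy(2,3) by (simp add: dim_eq_card_independent)
    moreover have "subspace K" unfolding xy(1) by simp
    moreover have "\<forall>x\<in>K. T x x x = 0" unfolding K_def using cube by auto
    ultimately show ?thesis by (simp add: zero_planes_def)
  qed
  have pL: "p = L 1 0 0" "u = L 0 1 0" "v = L 0 0 1" by (simp_all add: L_def)
  have KV1: "K \<noteq> V1"
  proof
    assume "K = V1"
    then show False using n1 KD[of 1 0 0] KD[of 0 1 0] p(1) u(1) pL by simp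
  qed
  have KV2: "K \<noteq> V2"
  proof
    assume "K = V2"
    then show False using n2 KD[of 1 0 0] KD[of 0 0 1] p(2) v(1) pL by simp
  qed
  have "V = K" if V: "V \<in> zero_planes" and d1: "V \<noteq> V1" and d2: "V \<noteq> V2" for V
  proof -
    note zV = zero_planes_trilinear[OF V] and sV = zero_planes_subspace[OF V]
    obtain x1 where x1: "x1 \<in> V" "x1 \<in> V1" "x1 \<noteq> 0" using zero_planes_meet[OF V V1] .
    obtain x2 where x2: "x2 \<in> V" "x2 \<in> V2" "x2 \<noteq> 0" using zero_planes_meet[OF V V2] .
    obtain \<alpha> \<beta> where ab: "x1 = L \<alpha> \<beta> 0"
      using x1(2) unfolding u(3) L_def by (auto simp: span_breakdown_eq algebra_simps)
    obtain \<gamma> \<delta> where cd: "x2 = L \<gamma> 0 \<delta>"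
      using x2(2) unfolding v(3) L_def by (auto simp: span_breakdown_eq algebra_simps)
    show ?thesis
    proof (cases "\<beta> = 0 \<or> \<delta> = 0")
      case True
      have pV: "p \<in> V"
      proof -
        have "\<exists>k. k \<noteq> 0 \<and> k *\<^sub>R p \<in> V"
          using True ab cd x1 x2 by (auto simp: L_def)
        then obtain k where k: "k \<noteq> 0" "k *\<^sub>R p \<in> V" by blast
        then have "(1/k) *\<^sub>R (k *\<^sub>R p) \<in> V" using subspace_scale[OF sV] by blast
        then show ?thesis using k by simp
      qed
      obtain y where y: "y \<in> V" "y \<notin> span {p}" "V = span {p, y}"
        using subspace_dim2_basis_containing[of V p] V pV p(3) unfolding zero_planes_def by blast
      \<comment> \<open>The functional \<open>T p p\<close> vanishes on \<open>p\<close>,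
        \<open>u\<close>, \<open>v\<close> and \<open>y\<close> but is positive at \<open>a\<close>.
        If \<open>y\<close> were outside the span, these four vectors would form a basis.\<close>
      have "y \<in> span {p, u, v}"
      proof (rule ccontr)
        assume ny: "y \<notin> span {p, u, v}"
        have "p \<noteq> u" "p \<noteq> 0" using u(2) p by (auto simp: span_base)
        then have "independent {p, u}"
          using u(2) independent2_iff[of u p] by (simp add: insert_commute)
        then have "independent {p, u, v}" "card {p, u, v} = 3"
          using independent3[of p u v] \<open>p \<noteq> u\<close> vV1 u(3) by auto
        then have "span {y, p, u, v} = UNIV" using full_span ny by blast
        then have "a \<in> span {y, p, u, v}" by simp
        then have "T p p a = 0"
          by (rule span_zero) (use z zV[OF pV pV y(1)] in auto)
        then show False using pos[OF p(3)] by simp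
      qed
      then obtain r s t where yL: "y = L r s t"
        unfolding L_def by (auto simp: span_breakdown_eq algebra_simps)
      have s0: "s \<noteq> 0"
      proof
        assume "s = 0"
        then have "y \<in> V2" unfolding yL L_def v(3)
          by (auto intro!: span_add span_scale simp: span_base)
        then have "V \<subseteq> V2" unfolding y(3) using p s2 by (intro span_minimal) auto
        then show False using zero_planes_eqI[OF V V2] d2 by simp
      qed
      have t0: "t \<noteq> 0"
      proof
        assume "t = 0"
        then have "y \<in> V1" unfolding yL L_def u(3)
          by (auto intro!: span_add span_scale simp: span_base)
        then have "V \<subseteq> V1" unfolding y(3) using p s1 by (intro span_minimal) auto
        then show False using zero_planes_eqI[OF V V1] d1 by simp
      qed
      have "T p y y = s * t * c0"
        using z unfolding yL L_def c0_def by (simp add: expand swaps)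
      then have c0: "c0 = 0" using zV[OF pV y(1) y(1)] s0 t0 by simp
      have "c0 * r + c1 * s + c2 * t = 0"
        using cube[of r s t] zV[OF y(1) y(1) y(1)] s0 t0 unfolding yL by simp
      then have "y \<in> K" "p \<in> K"
        using KI[of r s t] KI[of 1 0 0] c0 yL pL by simp_all
      then have "V \<subseteq> K" unfolding y(3) using zero_planes_subspace[OF K] by (intro span_minimal) auto
      then show ?thesis using zero_planes_eqI[OF V K] by simp
    next
      case False
      \<comment> \<open>Here \<open>V\<close> meets \<open>V1\<close> and \<open>V2\<close> away
        from the multiples of \<open>p\<close>. The two mixed values of \<open>T\<close> on
        \<open>x1\<close> and \<open>x2\<close> show that both vectors lie in
        \<open>K\<close>.\<close>
      have "T x1 x1 x2 = \<beta> * \<delta> * (c0 * \<alpha> + c1 * \<beta>)"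
        using z unfolding ab cd L_def c0_def c1_def by (simp add: expand swaps algebra_simps)
      then have "c0 * \<alpha> + c1 * \<beta> = 0" using False zV[OF x1(1) x1(1) x2(1)] by simp
      then have K1: "x1 \<in> K" unfolding ab by (intro KI) simp
      have "T x1 x2 x2 = \<beta> * \<delta> * (c0 * \<gamma> + c2 * \<delta>)"
        using z unfolding ab cd L_def c0_def c2_def by (simp add: expand swaps algebra_simps)
      then have "c0 * \<gamma> + c2 * \<delta> = 0" using False zV[OF x1(1) x2(1) x2(1)] by simp
      then have K2: "x2 \<in> K" unfolding cd by (intro KI) simp
      have "x2 \<notin> span {x1}"
      proof
        assume "x2 \<in> span {x1}"
        then obtain k where "x2 = k *\<^sub>R x1" by (auto simp: span_singleton)
        then have "L \<gamma> 0 \<delta> = L (k * \<alpha>) (k * \<beta>) 0"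
          unfolding ab cd by (simp add: L_def algebra_simps)
        then show False using Linj False by fastforce
      qed
      then have i: "independent {x2, x1}" "x2 \<noteq> x1"
        using independent2_iff x1(3) by blast+
      have "span {x2, x1} = V"
        by (rule subspace_dim_equal)
          (use i V x1 x2 sV span_minimal[of "{x2, x1}" V]
            in \<open>auto simp: dim_eq_card_independent zero_planes_def\<close>)
      moreover have "span {x2, x1} \<subseteq> K"
        using K1 K2 zero_planes_subspace[OF K] by (intro span_minimal) auto
      ultimately show ?thesis using zero_planes_eqI[OF V K] by simp
    qed
  qed
  then have "zero_planes = {V1, V2, K}" using V1 V2 K by blast
  then show ?thesis using that KV1 KV2 by blast
qed

end

section \<open>A second line from the residual conics of the first\<close>

lemma positive_right_neighbourhood:
  fixes h :: "real \<Rightarrow> real"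
  assumes "isCont h 0" "h 0 > 0"
  obtains \<delta> where "\<delta> > 0" "\<And>x. 0 < x \<Longrightarrow> x < \<delta> \<Longrightarrow> h x > 0"
proof -
  have "(h \<longlongrightarrow> h 0) (at_right 0)"
    using assms(1) by (simp add: isCont_def filterlim_at_split)
  then have "eventually (\<lambda>x. 0 < h x) (at_right 0)"
    using assms(2) by (rule order_tendstoD)
  then show ?thesis using that by (auto simp: eventually_at_right_field)
qed

context cubic_surface
begin

lemma other_plane:
  assumes V: "V \<in> zero_planes" and "x \<in> V" "x \<noteq> 0" "y \<notin> V"
    and "T x x y = 0" "T x y y = 0" "T y y y = 0"
  shows "\<exists>V'\<in>zero_planes. V' \<noteq> V"
proof
  have "span {x} \<subseteq> V"
    using V assms(2) by (intro span_minimal) (auto simp: zero_planes_def)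
  then have "y \<notin> span {x}" using assms(4) by blast
  then have "independent {x, y}" "x \<noteq> y"
    using independent2_iff[of y x] assms(3) by (auto simp: insert_commute)
  then show "span {x, y} \<in> zero_planes"
    using assms zero_planes_trilinear[OF V] by (intro span2_in_zero_planes) auto
  have "y \<in> span {x, y}" by (simp add: span_base)
  then show "span {x, y} \<noteq> V" using assms(4) by blast
qed

text \<open>As \<open>y\<close> varies, the restrictions of \<open>T _ _ y\<close> to
  \<open>V\<close> form a pencil of binary quadratic forms. In coordinates \<open>s\<close>,
  \<open>t\<close> along \<open>u\<close>, \<open>v\<close>, the vectors \<open>w\<close> and
  \<open>b\<close> represent its degenerate members \<open>s\<^sup>2\<close> and
  \<open>t\<^sup>2\<close>.\<close>

definition normal_frame :: "'a set \<Rightarrow> 'a \<Rightarrow> 'a \<Rightarrow> 'a \<Rightarrow> 'a \<Rightarrow> bool" where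
  "normal_frame V u v w b \<longleftrightarrow> u \<in> V \<and> v \<in> V \<and>
     T u u w = 1 \<and> T v v w = 0 \<and> T u v w = 0 \<and> T u u b = 0 \<and> T v v b = 1 \<and> T u v b = 0"

lemma normal_frame_swap: "normal_frame V u v w b \<Longrightarrow> normal_frame V v u b w"
  unfolding normal_frame_def by (simp add: swap12)

text \<open>On \<open>V\<close> the form of \<open>a\<close> is definite, so it can be diagonalised
  together with the form of a vector \<open>w0\<close> outside the span of \<open>V\<close> and
  \<open>a\<close>. Suitable combinations of \<open>a\<close> and \<open>w0\<close> then isolate the
  two squares.\<close>

lemma ex_normal_frame:
  assumes V: "V \<in> zero_planes"
  obtains u v w b where "normal_frame V u v w b"
proof -
  obtain u v1 where uv1: "independent {u, v1}" "u \<noteq> v1" "V = span {u, v1}"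
    using V subspace_dim2_basis unfolding zero_planes_def by blast
  obtain v where v: "T u u a = T v v a" "T u v a = 0" "u \<noteq> 0"
    "V = span {u, v}" "independent {u, v}" "u \<noteq> v"
    using orthogonal_basis[OF uv1(1,2)] uv1(3) by metis
  have uV: "u \<in> V" and vV: "v \<in> V"
    using v(4) by (auto intro: span_base)
  have "a \<notin> V"
    using zero_planes_trilinear[OF V uV uV] pos[OF v(3)] by fastforce
  have "card {u, v, a} = 3"
    using independent3[OF v(5,6)] \<open>a \<notin> V\<close> v(4) by auto
  have "dim {u, v, a} \<le> 3"
    using dim_le_card[OF span_superset, of "{u, v, a}"] \<open>card {u, v, a} = 3\<close> by simp
  then have "span {u, v, a} \<noteq> UNIV"
    using dim_eq_full[of "{u, v, a}"] dim4 by simp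
  then obtain w0 where w0: "w0 \<notin> span {u, v, a}" by blast
  define A B C where "A = T u u w0" and "B = T u v w0" and "C = T v v w0"
  define n0 where "n0 = T u u a"
  have n0: "n0 > 0" using pos[OF v(3)] by (simp add: n0_def)
  \<comment> \<open>Otherwise the forms of \<open>w0\<close> and \<open>a\<close> are proportional
    on \<open>V\<close>, and subtracting the multiple gives a plane tangent along
    \<open>V\<close>.\<close>
  have "A - C \<noteq> 0 \<or> B \<noteq> 0"
  proof (rule ccontr)
    assume "\<not> ?thesis"
    then have AB: "A = C" "B = 0" by auto
    define y where "y = w0 - (A / n0) *\<^sub>R a"
    have "y \<notin> V"
    proof
      assume "y \<in> V"
      then have "y \<in> span {u, v, a}"
        using v(4) span_mono[of "{u, v}" "{u, v, a}"] by auto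
      then have "y + (A / n0) *\<^sub>R a \<in> span {u, v, a}"
        by (intro span_add span_scale) (auto simp: span_base)
      then show False using w0 by (simp add: y_def)
    qed
    then show False
    proof (rule no_tangent_plane[OF V])
      fix x x' assume "x \<in> V" "x' \<in> V"
      then obtain r s r' s' where x: "x = r *\<^sub>R u + s *\<^sub>R v" "x' = r' *\<^sub>R u + s' *\<^sub>R v"
        unfolding v(4) by (auto simp: span_breakdown_eq algebra_simps)
      have "T u u y = 0" "T v v y = 0" "T u v y = 0"
        using AB n0 v(1,2) by (simp_all add: y_def expand A_def B_def C_def n0_def)
      then show "T x x' y = 0"
        unfolding x using swap12[of v u y] by (simp add: add1 add2 scale1 scale2)
    qed
  qed
  then have Dl: "(A - C)\<^sup>2 + 4 * B\<^sup>2 > 0"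
    by (metis add_nonneg_pos add_pos_nonneg mult_pos_pos zero_le_power2 zero_less_numeral
        zero_less_power2 mult_nonneg_nonneg zero_le_numeral)
  \<comment> \<open>The square root halves the angle: rotating (and scaling) the frame by
    \<open>c + i s\<close> makes the off-diagonal entry
    \<open>B * (c\<^sup>2 - s\<^sup>2) - (A - C) * (c * s)\<close> vanish.\<close>
  define \<zeta> where "\<zeta> = csqrt (Complex (A - C) (2 * B))"
  define c s where "c = Re \<zeta>" and "s = Im \<zeta>"
  have "\<zeta>\<^sup>2 = Complex (A - C) (2 * B)" by (simp add: \<zeta>_def)
  then have cs: "c\<^sup>2 - s\<^sup>2 = A - C" "c * s = B"
    by (auto simp: complex_eq_iff c_def s_def power2_eq_square)
  define n where "n = (c\<^sup>2 + s\<^sup>2) * n0"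
  have "c \<noteq> 0 \<or> s \<noteq> 0" using cs Dl by auto
  then have n: "n > 0" using n0 unfolding n_def
    by (simp add: sum_power2_gt_zero_iff)
  define u' v' where "u' = c *\<^sub>R u + s *\<^sub>R v" and "v' = c *\<^sub>R v - s *\<^sub>R u"
  have m: "u' \<in> V" "v' \<in> V"
    using uV vV zero_planes_def V unfolding u'_def v'_def
    by (auto intro!: subspace_add subspace_diff subspace_scale)
  have ea: "T u' u' a = n" "T v' v' a = n" "T u' v' a = 0"
    using v(1,2) swap12[of v u a] unfolding u'_def v'_def n_def n0_def
    by (simp_all add: add1 add2 diff1 diff2 scale1 scale2 algebra_simps power2_eq_square)
  define lam mu where "lam = T u' u' w0" and "mu = T v' v' w0"
  have "T u' v' w0 = B * (c\<^sup>2 - s\<^sup>2) - (A - C) * (c * s)"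
    using swap12[of v u w0] unfolding u'_def v'_def A_def B_def C_def
    by (simp add: add1 add2 diff1 diff2 scale1 scale2 algebra_simps power2_eq_square)
  then have ow: "T u' v' w0 = 0" unfolding cs by simp
  have "lam - mu = (c\<^sup>2 - s\<^sup>2) * (A - C) + 4 * (c * s) * B"
    using swap12[of v u w0] unfolding lam_def mu_def u'_def v'_def A_def B_def C_def
    by (simp add: add1 add2 diff1 diff2 scale1 scale2 algebra_simps power2_eq_square)
  then have lm: "lam - mu > 0" using Dl unfolding cs by (simp add: power2_eq_square)
  \<comment> \<open>Subtracting a multiple of \<open>a\<close> kills the entry at \<open>v'\<close>,
    and division by \<open>lam - mu\<close> normalises the one at \<open>u'\<close>. As
    \<open>(1 / n) *\<^sub>R a\<close> gives the sum of both squares, the difference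
    \<open>b\<close> gives the other square.\<close>
  define w where "w = (1 / (lam - mu)) *\<^sub>R (w0 - (mu / n) *\<^sub>R a)"
  define b where "b = (1 / n) *\<^sub>R a - w"
  have w: "T u' u' w = 1" "T v' v' w = 0" "T u' v' w = 0"
    using n lm ea ow by (simp_all add: w_def expand flip: lam_def mu_def)
  have b: "T u' u' b = 0" "T v' v' b = 1" "T u' v' b = 0"
    using n ea w by (simp_all add: b_def expand)
  show ?thesis using that[of u' v' w b] m w b by (simp add: normal_frame_def)
qed

text \<open>In the plane spanned by \<open>V\<close> and \<open>y = w - \<kappa> b\<close> the residual conic is
  \<open>3 (s\<^sup>2 - \<kappa> t\<^sup>2) + 3 r (s T u y y + t T v y y) + r\<^sup>2 T y y y\<close>; the
  following is its determinant up to the factor \<open>-9/4\<close>.\<close>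
definition residual_det :: "'a \<Rightarrow> 'a \<Rightarrow> 'a \<Rightarrow> 'a \<Rightarrow> real \<Rightarrow> real" where
  "residual_det u v w b \<kappa> =
     (let y = w - \<kappa> *\<^sub>R b in \<kappa> * (4 * T y y y - 3 * (T u y y)\<^sup>2) + 3 * (T v y y)\<^sup>2)"

lemma isCont_residual_det: "isCont (residual_det u v w b) x"
proof -
  have "residual_det u v w b = (\<lambda>\<kappa>. residual_det u v w b \<kappa>)" ..
  then show ?thesis
    unfolding residual_det_def Let_def by (simp add: expand)
qed

text \<open>\<open>w - \<kappa> b\<close> and \<open>b - (1/\<kappa>) w\<close> are proportional and
  so give the same residual conic. The minus sign is what makes the determinant change sign between
  small and large \<kappa>.\<close>

lemma residual_det_swap:
  assumes "\<kappa> > 0"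
  shows "residual_det u v w b \<kappa> = - (\<kappa> ^ 5) * residual_det v u b w (1 / \<kappa>)"
proof -
  define y' where "y' = b - (1/\<kappa>) *\<^sub>R w"
  have y: "w - \<kappa> *\<^sub>R b = (-\<kappa>) *\<^sub>R y'"
    using assms by (simp add: y'_def algebra_simps)
  show ?thesis
    using assms unfolding residual_det_def Let_def y y'_def[symmetric]
    by (simp only: scale1 scale2 scale3) (simp add: field_simps power2_eq_square eval_nat_numeral)
qed

text \<open>The value at 0 is \<open>3 * (T v w w)\<^sup>2\<close>. If it vanishes, the residual
  conic at 0 involves only \<open>r\<close> and \<open>s\<close>; being no pair of real lines, it
  has negative discriminant, and this makes the determinant grow linearly from 0.\<close>

lemma residual_det_pos_near_0:
  assumes V: "V \<in> zero_planes" and F: "normal_frame V u v w b"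
    and unique: "\<not> (\<exists>V'\<in>zero_planes. V' \<noteq> V)"
  obtains \<delta> where "\<delta> > 0" "\<And>\<kappa>. 0 < \<kappa> \<Longrightarrow> \<kappa> < \<delta> \<Longrightarrow> residual_det u v w b \<kappa> > 0"
proof (cases "T v w w = 0")
  case False
  then have "residual_det u v w b 0 > 0" by (simp add: residual_det_def)
  then show ?thesis
    using positive_right_neighbourhood[OF isCont_residual_det] that by blast
next
  case True
  note f = F[unfolded normal_frame_def] and zV = zero_planes_trilinear[OF V]
  have disc: "4 * T w w w - 3 * (T u w w)\<^sup>2 > 0"
  proof (rule ccontr)
    assume neg: "\<not> ?thesis"
    \<comment> \<open>A real root of the binary quadratic form that the residual conic has become.
      The corresponding second line is spanned by \<open>v\<close> and
      \<open>w + \<rho> u\<close>.\<close>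
    define \<rho> where "\<rho> = (- 3 * T u w w + sqrt (9 * (T u w w)\<^sup>2 - 12 * T w w w)) / 6"
    have "(6 * \<rho> + 3 * T u w w)\<^sup>2 = 9 * (T u w w)\<^sup>2 - 12 * T w w w"
    proof -
      have "6 * \<rho> + 3 * T u w w = sqrt (9 * (T u w w)\<^sup>2 - 12 * T w w w)"
        by (simp add: \<rho>_def field_simps)
      then show ?thesis using neg by simp
    qed
    then have \<rho>: "3 * \<rho>\<^sup>2 + 3 * \<rho> * T u w w + T w w w = 0"
      by (simp add: power2_eq_square algebra_simps)
    define y where "y = w + \<rho> *\<^sub>R u"
    have "T u u y = 1" using f zV by (simp add: y_def expand)
    then have "y \<notin> V" using f zV by fastforce
    moreover have "v \<noteq> 0" using f by auto
    moreover have "T v v y = 0" "T v y y = 0" "T y y y = 0"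
      using f zV True \<rho>
      by (simp_all add: y_def expand swaps power2_eq_square algebra_simps)
    ultimately show False
      using other_plane[OF V, of v y] f unique by blast
  qed
  \<comment> \<open>\<open>h\<close> is the determinant divided by \<kappa>; the division is
    possible because \<open>T v w w = 0\<close> makes \<open>T v y y\<close> a multiple of
    \<kappa>.\<close>
  define h where "h \<kappa> = (let y = w - \<kappa> *\<^sub>R b in
    4 * T y y y - 3 * (T u y y)\<^sup>2 + 3 * \<kappa> * (\<kappa> * T v b b - 2 * T v w b)\<^sup>2)" for \<kappa>
  have eq: "residual_det u v w b \<kappa> = \<kappa> * h \<kappa>" for \<kappa>
  proof -
    have "T v (w - \<kappa> *\<^sub>R b) (w - \<kappa> *\<^sub>R b) = \<kappa> * (\<kappa> * T v b b - 2 * T v w b)"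
      using True swap23[of v w b] by (simp add: diff2 diff3 scale2 scale3 algebra_simps)
    then show ?thesis
      unfolding residual_det_def h_def Let_def
      by (simp only:) (simp add: power2_eq_square algebra_simps)
  qed
  have "h = (\<lambda>\<kappa>. h \<kappa>)" ..
  then have "isCont h 0" unfolding h_def Let_def by (simp add: expand)
  moreover have "h 0 > 0" using disc by (simp add: h_def)
  ultimately obtain \<delta> where "\<delta> > 0" "\<And>x. 0 < x \<Longrightarrow> x < \<delta> \<Longrightarrow> h x > 0"
    using positive_right_neighbourhood by blast
  then show ?thesis using that[of \<delta>] eq by simp
qed

text \<open>The determinant is positive for small and negative for large \<kappa>. At a zero in
  between the residual conic is degenerate, and its part
  \<open>s\<^sup>2 - \<kappa> t\<^sup>2\<close> on \<open>V\<close> is indefinite, so it is a pair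
  of real lines.\<close>

lemma ex_second_zero_plane:
  assumes V: "V \<in> zero_planes"
  shows "\<exists>V'\<in>zero_planes. V' \<noteq> V"
proof (rule ccontr)
  assume unique: "\<not> ?thesis"
  obtain u v w b where F: "normal_frame V u v w b" using ex_normal_frame[OF V] .
  note f = F[unfolded normal_frame_def] and zV = zero_planes_trilinear[OF V]
  obtain \<delta> where \<delta>: "\<delta> > 0" "\<And>\<kappa>. 0 < \<kappa> \<Longrightarrow> \<kappa> < \<delta> \<Longrightarrow> residual_det u v w b \<kappa> > 0"
    using residual_det_pos_near_0[OF V F unique] by blast
  obtain \<delta>' where \<delta>': "\<delta>' > 0" "\<And>\<kappa>. 0 < \<kappa> \<Longrightarrow> \<kappa> < \<delta>' \<Longrightarrow> residual_det v u b w \<kappa> > 0"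
    using residual_det_pos_near_0[OF V normal_frame_swap[OF F] unique] by blast
  \<comment> \<open>The halving and doubling give the strict bounds \<open>k1 < \<delta>\<close> and
    \<open>1 / k2 < \<delta>'\<close>; the cut at 1 gives \<open>k1 \<le> k2\<close>.\<close>
  define k1 where "k1 = min \<delta> 1 / 2"
  define k2 where "k2 = max 1 (2 / \<delta>')"
  have k: "0 < k1" "k1 < \<delta>" "k1 \<le> k2" "0 < k2" "1 / k2 < \<delta>'"
  proof -
    show "0 < k1" "k1 < \<delta>" "0 < k2" using \<delta>(1) by (auto simp: k1_def k2_def)
    show "k1 \<le> k2" by (auto simp: k1_def k2_def)
    have "2 / \<delta>' \<le> k2" by (simp add: k2_def)
    then show "1 / k2 < \<delta>'" using \<delta>'(1) \<open>0 < k2\<close> by (simp add: field_simps)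
  qed
  have "residual_det u v w b k1 > 0" using \<delta>(2) k by simp
  moreover have "residual_det u v w b k2 < 0"
    using residual_det_swap[OF k(4)] \<delta>'(2)[of "1 / k2"] k by simp
  ultimately obtain \<kappa> where \<kappa>: "k1 \<le> \<kappa>" "\<kappa> \<le> k2" "residual_det u v w b \<kappa> = 0"
    using IVT2[of "residual_det u v w b" k2 0 k1] isCont_residual_det k(3) by (metis less_imp_le)
  have kp: "\<kappa> > 0" using \<kappa>(1) k(1) by linarith
  define q where "q = sqrt \<kappa>"
  have q: "q * q = \<kappa>" using kp by (simp add: q_def)
  define y where "y = w - \<kappa> *\<^sub>R b"
  have ty: "T u u y = 1" "T v v y = - \<kappa>" "T u v y = 0"
    using f by (simp_all add: y_def expand)
  define P R S where "P = T u y y" and "R = T v y y" and "S = T y y y"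
  have D: "\<kappa> * (4 * S - 3 * P\<^sup>2) + 3 * R\<^sup>2 = 0"
    using \<kappa>(3) by (simp add: residual_det_def Let_def y_def P_def R_def S_def)
  then have D': "3 * (R * R) / (4 * \<kappa>) + (S - 3 * (P * P) / 4) = 0"
    using kp by (simp add: field_simps power2_eq_square)
  define x1 where "x1 = q *\<^sub>R u + v"
  define x2 where "x2 = y - (P / 2) *\<^sub>R u + (R / (2 * \<kappa>)) *\<^sub>R v"
  note zs = zV[of u u u] zV[of u u v] zV[of u v v] zV[of v v v]
  have "T x1 x1 b = 1" using f by (simp add: x1_def expand swap12[of v u])
  then have "x1 \<noteq> 0" by auto
  moreover have "x1 \<in> V"
    using f V unfolding x1_def zero_planes_def by (auto intro!: subspace_add subspace_scale)
  moreover have "T u u x2 = 1"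
    using f zs ty by (simp add: x2_def expand)
  then have "x2 \<notin> V" using f zV by fastforce
  moreover have "T x1 x1 x2 = 0"
    using f zs ty q unfolding x1_def x2_def
    by (simp add: expand swaps)
  moreover have "T x1 x2 x2 = 0"
    using f zs ty kp P_def R_def unfolding x1_def x2_def
    by (simp add: expand swaps)
  moreover have "T x2 x2 x2 = 0"
    using f zs ty kp P_def R_def S_def D' unfolding x2_def
    by (simp add: expand swaps)
  ultimately show False
    using other_plane[OF V, of x1 x2] unique by blast
qed

end

section \<open>Existence of a first line by a winding argument\<close>

lemma real_cubic_root:
  fixes c0 c1 c2 c3 :: real
  assumes "c3 > 0"
  shows "\<exists>t. c0 + c1 * t + c2 * t\<^sup>2 + c3 * t ^ 3 = 0"
proof -
  define s where "s = \<bar>c0\<bar> + \<bar>c1\<bar> + \<bar>c2\<bar>"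
  \<comment> \<open>Chosen so that \<open>c3 * M\<close> exceeds the sum \<open>s\<close> of the
    other absolute coefficients. The leading term then determines the sign at \<open>M\<close> and
    \<open>- M\<close>.\<close>
  define M where "M = s / c3 + 1"
  define h where "h t = c0 + c1 * t + c2 * t\<^sup>2 + c3 * t ^ 3" for t
  have M: "1 \<le> M" and c3M: "c3 * M = s + c3"
    using assms by (simp_all add: M_def s_def field_simps)
  have M2: "1 \<le> M\<^sup>2" "M \<le> M\<^sup>2" using M by (simp_all add: self_le_power one_le_power)
  have b: "\<bar>c0\<bar> + \<bar>c1\<bar> * M + \<bar>c2\<bar> * M\<^sup>2 < c3 * M ^ 3"
  proof -
    have "\<bar>c0\<bar> * 1 + \<bar>c1\<bar> * M + \<bar>c2\<bar> * M\<^sup>2 \<le> \<bar>c0\<bar> * M\<^sup>2 + \<bar>c1\<bar> * M\<^sup>2 + \<bar>c2\<bar> * M\<^sup>2"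
      using M2 by (intro add_mono mult_left_mono) auto
    also have "\<dots> = s * M\<^sup>2" by (simp add: s_def algebra_simps)
    also have "\<dots> < (s + c3) * M\<^sup>2"
      using assms M2 by (intro mult_strict_right_mono) auto
    also have "\<dots> = c3 * M ^ 3"
      unfolding c3M[symmetric] by (simp add: power2_eq_square power3_eq_cube)
    finally show ?thesis by simp
  qed
  have a: "\<bar>c1 * M\<bar> = \<bar>c1\<bar> * M" "\<bar>c2 * M\<^sup>2\<bar> = \<bar>c2\<bar> * M\<^sup>2"
    using M by (simp_all add: abs_mult)
  have "h (- M) \<le> 0" "h M \<ge> 0"
    using b a abs_ge_self[of "c1 * M"] abs_ge_self[of "c2 * M\<^sup>2"]
      abs_ge_minus_self[of "c1 * M"] abs_ge_minus_self[of "c2 * M\<^sup>2"]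
      abs_ge_self[of c0] abs_ge_minus_self[of c0]
    by (simp_all add: h_def power3_eq_cube)
  moreover have "\<forall>x. isCont h x" unfolding h_def by simp
  ultimately show ?thesis
    using IVT[of h "- M" 0 M] M unfolding h_def by auto
qed

text \<open>A logarithm of \<open>F\<close> would grow by the same odd multiple of \<open>\<pi>\<i>/2\<close> over each of the
  eight arcs into which the powers of \<open>cis (pi/4)\<close> divide the circle.\<close>
lemma no_quarter_equivariant_map:
  fixes F :: "complex \<Rightarrow> complex"
  assumes cont: "continuous_on (cball 0 1) F"
    and nz: "\<And>z. z \<in> cball 0 1 \<Longrightarrow> F z \<noteq> 0"
    and eqv: "\<And>z. norm z = 1 \<Longrightarrow> F (cis (pi/4) * z) = \<i> * F z"
  shows False
proof -
  obtain h where h: "continuous_on (cball 0 1) h" "\<And>z. z \<in> cball 0 1 \<Longrightarrow> F z = exp (h z)"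
    using continuous_logarithm_on_cball[OF cont nz] by blast
  define d where "d z = h (cis (pi/4) * z) - h z" for z
  have expd: "exp (d z) = \<i>" if "norm z = 1" for z
  proof -
    have "exp (h (cis (pi/4) * z)) = \<i> * exp (h z)"
      using eqv[OF that] h(2)[of z] h(2)[of "cis (pi/4) * z"] that
      by (simp add: norm_mult)
    then show ?thesis by (simp add: d_def exp_diff)
  qed
  have "continuous_on (sphere 0 1) d"
    unfolding d_def
    by (intro continuous_intros continuous_on_compose2[OF h(1)]) (auto simp: norm_mult)
  then have "d constant_on sphere 0 1"
  proof (rule continuous_discrete_range_constant[rotated])
    show "connected (sphere (0::complex) 1)" by (intro connected_sphere) simp
    fix x :: complex assume x: "x \<in> sphere 0 1"
    \<comment> \<open>All values of \<open>d\<close> are logarithms of \<open>\<i>\<close>, so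
      distinct ones differ by at least \<open>2 * pi\<close>.\<close>
    show "\<exists>e>0. \<forall>y. y \<in> sphere 0 1 \<and> d y \<noteq> d x \<longrightarrow> e \<le> norm (d y - d x)"
    proof (intro exI[of _ 1] conjI allI impI)
      fix y assume y: "y \<in> sphere 0 1 \<and> d y \<noteq> d x"
      then have "exp (d y) = exp (d x)" using expd x by simp
      then obtain n :: int where n: "d y = d x + (of_int (2 * n) * pi) * \<i>"
        using exp_eq by blast
      have "n \<noteq> 0" using n y by auto
      then have "1 \<le> \<bar>real_of_int n\<bar>" by linarith
      then have "1 * 1 \<le> (2 * \<bar>real_of_int n\<bar>) * pi"
        using pi_gt3 by (intro mult_mono) auto
      also have "\<dots> = norm (d y - d x)" unfolding n by (simp add: norm_mult)
      finally show "1 \<le> norm (d y - d x)" by simp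
    qed simp
  qed
  then obtain c where c: "\<And>z. norm z = 1 \<Longrightarrow> d z = c"
    unfolding constant_on_def by (metis mem_sphere_0)
  let ?h = "\<lambda>k. h (cis (pi/4) ^ k)"
  have "(\<Sum>k<8. ?h (Suc k) - ?h k) = ?h 8 - ?h 0"
    by (rule sum_lessThan_telescope)
  moreover have "?h (Suc k) - ?h k = c" for k
    using c[of "cis (pi/4) ^ k"] by (simp add: d_def norm_power)
  moreover have "cis (pi/4) ^ 8 = 1" by (simp add: Complex.DeMoivre)
  ultimately have "c = 0" by simp
  then show False using expd[of 1] c[of 1] by simp
qed

context cubic_surface
begin

lemma cube_root_ex1: "\<exists>!t. T (x + t *\<^sub>R a) (x + t *\<^sub>R a) (x + t *\<^sub>R a) = 0"
proof -
  obtain t where "T x x x + (3 * T x x a) * t + (3 * T x a a) * t\<^sup>2 + T a a a * t ^ 3 = 0"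
    using real_cubic_root[OF pos[OF a_nonzero]] by blast
  then have "T (x + t *\<^sub>R a) (x + t *\<^sub>R a) (x + t *\<^sub>R a) = 0"
    by (simp add: expand swaps algebra_simps power2_eq_square power3_eq_cube)
  moreover have "s = t"
    if "T (x + s *\<^sub>R a) (x + s *\<^sub>R a) (x + s *\<^sub>R a) = 0" for s
    using cube_shift_eq[OF that calculation, of "s - t"] by (simp add: algebra_simps)
  ultimately show ?thesis by blast
qed

text \<open>The function whose graph over directions complementary to \<open>a\<close> is the zero
  set; \<open>lift x\<close> is the unique zero of the cubic on the line through \<open>x\<close> in
  the direction \<open>a\<close>.\<close>

definition height :: "'a \<Rightarrow> real" where
  "height x = (THE t. T (x + t *\<^sub>R a) (x + t *\<^sub>R a) (x + t *\<^sub>R a) = 0)"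

definition lift :: "'a \<Rightarrow> 'a" where
  "lift x = x + height x *\<^sub>R a"

lemma cube_lift: "T (lift x) (lift x) (lift x) = 0"
  using theI'[OF cube_root_ex1[of x]] by (simp add: lift_def height_def)

lemma height_eqI: "T (x + t *\<^sub>R a) (x + t *\<^sub>R a) (x + t *\<^sub>R a) = 0 \<Longrightarrow> height x = t"
  using cube_root_ex1[of x] by (auto simp: height_def)

lemma lift_minus: "lift (- x) = - lift x"
proof -
  have "T (- x + (- height x) *\<^sub>R a) (- x + (- height x) *\<^sub>R a) (- x + (- height x) *\<^sub>R a)
      = - T (lift x) (lift x) (lift x)"
    unfolding lift_def by (simp add: expand algebra_simps)
  then have "height (- x) = - height x"
    using cube_lift[of x] by (intro height_eqI) simp
  then show ?thesis by (simp add: lift_def)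
qed

lemma cube_less_iff:
  "T (x + s *\<^sub>R a) (x + s *\<^sub>R a) (x + s *\<^sub>R a) < T (x + t *\<^sub>R a) (x + t *\<^sub>R a) (x + t *\<^sub>R a)
    \<longleftrightarrow> s < t"
  using cube_strict_mono[of s t x] cube_strict_mono[of t s x]
  by (cases s t rule: linorder_cases) auto

text \<open>Whether \<open>height y\<close> lies above or below \<open>t\<close> is the sign of the
  cubic at \<open>y + t *\<^sub>R a\<close>, and both strict inequalities are open conditions on
  \<open>y\<close>.\<close>

lemma isCont_height: "isCont height x"
proof -
  have neg: "T (y + t *\<^sub>R a) (y + t *\<^sub>R a) (y + t *\<^sub>R a) < 0 \<longleftrightarrow> t < height y"
    and pos: "T (y + t *\<^sub>R a) (y + t *\<^sub>R a) (y + t *\<^sub>R a) > 0 \<longleftrightarrow> t > height y" for y t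
    using cube_less_iff[of y t "height y"] cube_less_iff[of y "height y" t] cube_lift[of y]
    by (simp_all add: lift_def)
  have cont: "isCont (\<lambda>y. T (y + t *\<^sub>R a) (y + t *\<^sub>R a) (y + t *\<^sub>R a)) x" for t
  proof -
    have "continuous_on UNIV (\<lambda>y. T (y + t *\<^sub>R a) (y + t *\<^sub>R a) (y + t *\<^sub>R a))"
      by (intro continuous_intros)
    then show ?thesis by (simp add: continuous_on_eq_continuous_at)
  qed
  have "(height \<longlongrightarrow> height x) (at x)"
  proof (rule order_tendstoI)
    fix t assume "t < height x"
    then show "eventually (\<lambda>y. t < height y) (at x)"
      using order_tendstoD(2)[OF cont[of t, unfolded isCont_def], of 0] by (simp add: neg)
  next
    fix t assume "height x < t"
    then show "eventually (\<lambda>y. height y < t) (at x)"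
      using order_tendstoD(1)[OF cont[of t, unfolded isCont_def], of 0] by (simp add: pos)
  qed
  then show ?thesis by (simp add: isCont_def)
qed

lemma continuous_on_lift [continuous_intros]:
  "continuous_on S h \<Longrightarrow> continuous_on S (\<lambda>x. lift (h x))"
proof -
  assume h: "continuous_on S h"
  have "continuous_on UNIV height"
    using isCont_height by (simp add: continuous_on_eq_continuous_at)
  then show ?thesis
    unfolding lift_def using h
    by (intro continuous_intros continuous_on_compose2[of UNIV height S h]) auto
qed

lemma ex_complement_basis:
  obtains e1 e2 e3 where
    "\<And>x y z r. x *\<^sub>R e1 + y *\<^sub>R e2 + z *\<^sub>R e3 = r *\<^sub>R a \<Longrightarrow> x = 0 \<and> y = 0 \<and> z = 0"
proof -
  have "independent {a}" using a_nonzero by simp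
  then obtain B where B: "{a} \<subseteq> B" "independent B" "UNIV \<subseteq> span B"
    using maximal_independent_subset_extend[of "{a}" UNIV] by auto
  have "card B = 4"
    using B dim4 basis_card_eq_dim[of B UNIV] by (simp add: dim_UNIV)
  have "finite B" using B(2) independent_imp_finite by blast
  then have "card (B - {a}) = 3" using \<open>card B = 4\<close> B(1) by simp
  then obtain e1 e2 e3 where e: "B - {a} = {e1, e2, e3}" "e1 \<noteq> e2" "e2 \<noteq> e3" "e1 \<noteq> e3"
    by (auto simp: card_3_iff)
  then have Be: "B = {a, e1, e2, e3}" "a \<noteq> e1" "a \<noteq> e2" "a \<noteq> e3" using B(1) by auto
  show ?thesis
  proof
    fix x y z r assume l: "x *\<^sub>R e1 + y *\<^sub>R e2 + z *\<^sub>R e3 = r *\<^sub>R a"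
    define u where "u b = (if b = a then - r else if b = e1 then x else if b = e2 then y else z)" for b
    have "(\<Sum>b\<in>B. u b *\<^sub>R b) = 0"
      using e(2-4) Be l by (simp add: u_def algebra_simps)
    then have "\<forall>b\<in>B. u b = 0"
      using B(2) \<open>finite B\<close> independentD[of B B u] by auto
    then show "x = 0 \<and> y = 0 \<and> z = 0"
      using e(2-4) Be by (auto simp: u_def)
  qed
qed

text \<open>For a frame \<open>b\<^sub>1, b\<^sub>2\<close> of a plane complementary to \<open>a\<close>, the cubic vanishes on the span of
  \<open>u = lift b\<^sub>1\<close> and \<open>v = lift b\<^sub>2\<close> as soon as it vanishes at \<open>u \<plusminus> v\<close>. A quarter turn
  \<open>(b\<^sub>1, b\<^sub>2) \<mapsto> (b\<^sub>2, -b\<^sub>1)\<close> multiplies \<open>T (u+v)\<^sup>3 + \<i> T (u-v)\<^sup>3\<close> by \<open>\<i>\<close>. The frames are the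
  first two columns of the rotation matrix of the unit quaternion \<open>x + r i + z k\<close>, so that
  on the boundary of the disc \<open>r = 0\<close> and \<open>b\<^sub>1, b\<^sub>2\<close> rotate in their plane with double speed.\<close>
lemma ex_zero_plane: "zero_planes \<noteq> {}"
proof
  assume none: "zero_planes = {}"
  obtain e1 e2 e3 where e: "\<And>x y z r. x *\<^sub>R e1 + y *\<^sub>R e2 + z *\<^sub>R e3 = r *\<^sub>R a
      \<Longrightarrow> x = 0 \<and> y = 0 \<and> z = 0"
    using ex_complement_basis by blast
  define r where "r w = sqrt (1 - (norm w)\<^sup>2)" for w :: complex
  define b1 where "b1 w = ((Re w)\<^sup>2 + (r w)\<^sup>2 - (Im w)\<^sup>2) *\<^sub>R e1 + (2 * Re w * Im w) *\<^sub>R e2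
      + (2 * r w * Im w) *\<^sub>R e3" for w
  define b2 where "b2 w = (- 2 * Re w * Im w) *\<^sub>R e1 + ((Re w)\<^sup>2 - (r w)\<^sup>2 - (Im w)\<^sup>2) *\<^sub>R e2
      + (2 * r w * Re w) *\<^sub>R e3" for w
  define U V where "U w = lift (b1 w)" and "V w = lift (b2 w)" for w
  define F where "F w = Complex (T (U w + V w) (U w + V w) (U w + V w))
      (T (U w - V w) (U w - V w) (U w - V w))" for w
  have cont: "continuous_on (cball 0 1) F"
  proof -
    have "continuous_on (cball 0 1) U" "continuous_on (cball 0 1) V"
      unfolding U_def V_def b1_def b2_def r_def by (intro continuous_intros)+
    then show ?thesis
      unfolding F_def Complex_eq by (intro continuous_intros)
  qed
  have nz: "F w \<noteq> 0" if w: "w \<in> cball 0 1" for w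
  proof
    assume F0: "F w = 0"
    have "(norm w)\<^sup>2 \<le> 1" using w by (simp add: power_le_one)
    then have rw: "(Re w)\<^sup>2 + (Im w)\<^sup>2 + (r w)\<^sup>2 = 1"
      by (simp add: r_def cmod_power2)
    have frame: "s = 0 \<and> t = 0" if "s *\<^sub>R b1 w + t *\<^sub>R b2 w = k *\<^sub>R a" for s t k
    proof -
      have "(s * ((Re w)\<^sup>2 + (r w)\<^sup>2 - (Im w)\<^sup>2) + t * (- 2 * Re w * Im w)) *\<^sub>R e1
        + (s * (2 * Re w * Im w) + t * ((Re w)\<^sup>2 - (r w)\<^sup>2 - (Im w)\<^sup>2)) *\<^sub>R e2
        + (s * (2 * r w * Im w) + t * (2 * r w * Re w)) *\<^sub>R e3 = k *\<^sub>R a"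
        using that unfolding b1_def b2_def by (simp add: algebra_simps)
      then have z: "s * ((Re w)\<^sup>2 + (r w)\<^sup>2 - (Im w)\<^sup>2) + t * (- 2 * Re w * Im w) = 0"
        "s * (2 * Re w * Im w) + t * ((Re w)\<^sup>2 - (r w)\<^sup>2 - (Im w)\<^sup>2) = 0"
        "s * (2 * r w * Im w) + t * (2 * r w * Re w) = 0"
        using e by blast+
      \<comment> \<open>The coefficient columns of \<open>b1 w\<close> and \<open>b2 w\<close> are
        orthogonal, and their common length is the squared norm of the quaternion.\<close>
      have "(s\<^sup>2 + t\<^sup>2) * ((Re w)\<^sup>2 + (Im w)\<^sup>2 + (r w)\<^sup>2)\<^sup>2
        = (s * ((Re w)\<^sup>2 + (r w)\<^sup>2 - (Im w)\<^sup>2) + t * (- 2 * Re w * Im w))\<^sup>2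
        + (s * (2 * Re w * Im w) + t * ((Re w)\<^sup>2 - (r w)\<^sup>2 - (Im w)\<^sup>2))\<^sup>2
        + (s * (2 * r w * Im w) + t * (2 * r w * Re w))\<^sup>2"
        by algebra
      then have "s\<^sup>2 + t\<^sup>2 = 0" unfolding rw z by simp
      then show ?thesis by (simp add: sum_power2_eq_zero_iff)
    qed
    have ind: "s = 0 \<and> t = 0" if "s *\<^sub>R U w + t *\<^sub>R V w = 0" for s t
    proof -
      have "s *\<^sub>R b1 w + t *\<^sub>R b2 w + (s * height (b1 w) + t * height (b2 w)) *\<^sub>R a = 0"
        using that unfolding U_def V_def lift_def by (simp add: algebra_simps)
      then have "s *\<^sub>R b1 w + t *\<^sub>R b2 w = (- (s * height (b1 w) + t * height (b2 w))) *\<^sub>R a"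
        by (simp only: scaleR_minus_left eq_neg_iff_add_eq_0)
      then show ?thesis using frame by blast
    qed
    have "V w \<noteq> 0" using ind[of 0 1] by auto
    moreover have "U w \<notin> span {V w}"
    proof
      assume "U w \<in> span {V w}"
      then obtain k where "U w = k *\<^sub>R V w" by (auto simp: span_singleton)
      then show False using ind[of 1 "- k"] by simp
    qed
    ultimately have i: "independent {U w, V w}" "U w \<noteq> V w"
      using independent2_iff by blast+
    have c: "T (U w) (U w) (U w) = 0" "T (V w) (V w) (V w) = 0"
      unfolding U_def V_def by (rule cube_lift)+
    have "T (U w + V w) (U w + V w) (U w + V w) = 0" "T (U w - V w) (U w - V w) (U w - V w) = 0"
      using F0 by (simp_all add: F_def complex_eq_iff)
    then have "T (U w) (U w) (V w) + T (U w) (V w) (V w) = 0"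
      "T (U w) (V w) (V w) - T (U w) (U w) (V w) = 0"
      using c by (simp_all add: expand swaps)
    then have "T (U w) (U w) (V w) = 0" "T (U w) (V w) (V w) = 0" by simp_all
    then have "span {U w, V w} \<in> zero_planes"
      using i c by (intro span2_in_zero_planes)
    then show False using none by simp
  qed
  have eqv: "F (cis (pi/4) * w) = \<i> * F w" if w: "norm w = 1" for w
  proof -
    have r0: "r w = 0" "r (cis (pi/4) * w) = 0"
      using w by (simp_all add: r_def norm_mult)
    have "cis (pi/4) ^ 2 = \<i>" by (simp add: Complex.DeMoivre)
    then have sq: "(cis (pi/4) * w)\<^sup>2 = \<i> * w\<^sup>2"
      by (simp add: power_mult_distrib)
    \<comment> \<open>On the boundary the frame is rotated by \<open>y\<^sup>2\<close>, so
      multiplying \<open>y\<close> by \<open>cis (pi/4)\<close> is a quarter turn of the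
      frame.\<close>
    have b: "b1 y = Re (y\<^sup>2) *\<^sub>R e1 + Im (y\<^sup>2) *\<^sub>R e2"
      "b2 y = (- Im (y\<^sup>2)) *\<^sub>R e1 + Re (y\<^sup>2) *\<^sub>R e2" if "r y = 0" for y
      using that by (simp_all add: b1_def b2_def power2_eq_square)
    have "b1 (cis (pi/4) * w) = b2 w" "b2 (cis (pi/4) * w) = - b1 w"
      unfolding b[OF r0(1)] b[OF r0(2)] sq by simp_all
    then have UV: "U (cis (pi/4) * w) = V w" "V (cis (pi/4) * w) = - U w"
      unfolding U_def V_def using lift_minus by simp_all
    show ?thesis
      unfolding F_def UV by (simp add: complex_eq_iff expand swaps)
  qed
  show False
    using no_quarter_equivariant_map[OF cont nz eqv] .
qed

end

lemma (in cubic_surface) card_zero_planes: "card zero_planes = 3"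
proof -
  obtain V1 where V1: "V1 \<in> zero_planes" using ex_zero_plane by blast
  obtain V2 where V2: "V2 \<in> zero_planes" "V2 \<noteq> V1" using ex_second_zero_plane[OF V1] by blast
  obtain V3 where "V3 \<noteq> V1" "V3 \<noteq> V2" "zero_planes = {V1, V2, V3}"
    using zero_planes_eq_three[OF V1 V2(1)] V2(2) by metis
  then show ?thesis using V2(2) by auto
qed

section \<open>Gaussian integrals of polynomials\<close>

text \<open>Fubini's theorem. Since \<open>lborel\<close> is the image of a product measure indexed
  by \<open>Basis\<close>, the coordinates are translated by \<open>i \<mapsto> axis i 1\<close> and
  its inverse \<open>ix\<close>.\<close>

lemma has_bochner_integral_prod_vec:
  fixes \<psi> :: "'n::finite \<Rightarrow> real \<Rightarrow> real"
  assumes "\<And>i. has_bochner_integral lborel (\<psi> i) (I i)"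
  shows "has_bochner_integral lborel (\<lambda>x::real^'n. \<Prod>i\<in>UNIV. \<psi> i (x $ i)) (\<Prod>i\<in>UNIV. I i)"
proof -
  interpret product_sigma_finite "\<lambda>_::real^'n. lborel :: real measure" ..
  define ix where "ix b = (THE i. b = axis i (1::real))" for b :: "real^'n"
  have ix: "ix (axis i 1) = i" for i
    unfolding ix_def by (rule the_equality) (simp_all add: axis_eq_axis)
  have inj: "inj (\<lambda>i::'n. axis i (1::real))"
    by (rule injI) (simp add: axis_eq_axis)
  have B: "(Basis :: (real^'n) set) = range (\<lambda>i. axis i 1)"
    by (auto simp: Basis_vec_def)
  have re: "(\<Prod>b\<in>Basis. h b) = (\<Prod>i\<in>UNIV. h (axis i 1))" for h :: "real^'n \<Rightarrow> real"
    unfolding B by (subst prod.reindex[OF inj]) simp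
  have int: "integrable lborel (\<psi> i)" "integral\<^sup>L lborel (\<psi> i) = I i" for i
    using assms[of i] by (auto simp: has_bochner_integral_iff)
  then have [measurable]: "\<psi> i \<in> borel_measurable borel" for i
    by (metis borel_measurable_integrable measurable_lborel2)
  let ?P = "\<Pi>\<^sub>M b\<in>(Basis :: (real^'n) set). (lborel :: real measure)"
  let ?S = "\<lambda>f. \<Sum>b\<in>(Basis :: (real^'n) set). f b *\<^sub>R b"
  have eq: "(\<Prod>i\<in>UNIV. \<psi> i (?S f $ i)) = (\<Prod>b\<in>Basis. \<psi> (ix b) (f b))" for f
  proof -
    have "?S f $ i = f (axis i 1)" for i
    proof -
      have "?S f $ i = ?S f \<bullet> axis i 1" by (simp add: inner_axis)
      also have "\<dots> = f (axis i 1)" by (rule inner_sum_left_Basis) simp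
      finally show ?thesis .
    qed
    then show ?thesis unfolding re ix by simp
  qed
  have m: "?S \<in> measurable ?P borel" by measurable
  have "integrable ?P (\<lambda>f. \<Prod>b\<in>Basis. \<psi> (ix b) (f b))"
    by (rule product_integrable_prod) (simp_all add: int)
  moreover have "integral\<^sup>L ?P (\<lambda>f. \<Prod>b\<in>Basis. \<psi> (ix b) (f b)) = (\<Prod>b\<in>Basis. integral\<^sup>L lborel (\<psi> (ix b)))"
    by (rule product_integral_prod) (simp_all add: int)
  ultimately have h: "has_bochner_integral ?P (\<lambda>f. \<Prod>b\<in>Basis. \<psi> (ix b) (f b)) (\<Prod>i\<in>UNIV. I i)"
    unfolding has_bochner_integral_iff re ix int by simp
  let ?g = "\<lambda>x::real^'n. \<Prod>i\<in>UNIV. \<psi> i (x $ i)"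
  have "?g \<in> borel_measurable borel" by measurable
  moreover have "has_bochner_integral ?P (\<lambda>f. ?g (?S f)) (\<Prod>i\<in>UNIV. I i)"
    using h by (simp only: eq)
  ultimately have "has_bochner_integral (distr ?P borel ?S) ?g (\<Prod>i\<in>UNIV. I i)"
    by (intro has_bochner_integral_distr m)
  then show ?thesis
    by (simp only: lborel_eq[symmetric])
qed

section \<open>The Gaussian weight, its moments and Hermite polynomials\<close>

definition gauss :: "real^'n::finite \<Rightarrow> real" where
  "gauss x = (\<Prod>i\<in>UNIV. std_normal_density (x $ i))"

lemma gauss_eq: "gauss (x :: real^4) = 1 / (4 * pi\<^sup>2) * exp (- (norm x)\<^sup>2 / 2)"
proof -
  have "(norm x)\<^sup>2 = (\<Sum>i\<in>UNIV. (x $ i)\<^sup>2)"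
    unfolding power2_norm_eq_inner inner_vec_def by (simp add: power2_eq_square)
  then have "exp (- (norm x)\<^sup>2 / 2) = exp (\<Sum>i\<in>UNIV. - (x $ i)\<^sup>2 / 2)"
    by (simp add: sum_negf sum_divide_distrib)
  also have "\<dots> = (\<Prod>i\<in>UNIV. exp (- (x $ i)\<^sup>2 / 2))"
    by (simp add: exp_sum)
  finally have "gauss x = (1 / sqrt (2 * pi)) ^ 4 * exp (- (norm x)\<^sup>2 / 2)"
    by (simp only: gauss_def std_normal_density_def prod.distrib) simp
  moreover have "sqrt (2 * pi) ^ 4 = ((sqrt (2 * pi))\<^sup>2)\<^sup>2"
    by (simp only: power_mult[symmetric]) simp
  then have "sqrt (2 * pi) ^ 4 = 4 * pi\<^sup>2" by (simp add: power_mult_distrib)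
  ultimately show ?thesis by (simp add: power_divide)
qed

lemma gauss_nonneg: "gauss x \<ge> 0"
  unfolding gauss_def by (intro prod_nonneg) simp

lemma inner_L2_eq: "inner_L2 f g = (\<integral>x. eval f x * eval g x * gauss x \<partial>lborel)"
proof -
  have "(\<integral>x. eval f x * eval g x * gauss x \<partial>lborel)
    = (\<integral>x. (1 / (4 * pi\<^sup>2)) * (eval f x * eval g x * exp (- (norm x)\<^sup>2 / 2)) \<partial>lborel)"
    unfolding gauss_eq by (intro Bochner_Integration.integral_cong) simp_all
  also have "\<dots> = inner_L2 f g"
    unfolding inner_L2_def by simp
  finally show ?thesis ..
qed

text \<open>The moments of the standard normal distribution; for even \<open>k\<close> this is the
  double factorial \<open>(k - 1)!!\<close>.\<close>

definition moment :: "nat \<Rightarrow> real" where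
  "moment k = (if even k then fact k / (2 ^ (k div 2) * fact (k div 2)) else 0)"

lemma moment_simps [simp]:
  "moment 0 = 1" "moment (Suc 0) = 0" "moment (Suc (Suc 0)) = 1" "moment (Suc (Suc (Suc 0))) = 0"
  "moment (Suc (Suc (Suc (Suc 0)))) = 3"
  "moment 2 = 1" "moment 3 = 0" "moment 4 = 3"
  "moment 5 = 0" "moment 6 = 15"
  by (simp_all add: moment_def fact_numeral)

lemma has_bochner_integral_moment:
  "has_bochner_integral lborel (\<lambda>t. t ^ k * std_normal_density t) (moment k)"
proof (cases "even k")
  case True
  then obtain j where "k = 2 * j" by blast
  then show ?thesis
    using normal_moment_even[of 1 0 j] by (simp add: moment_def mult.commute)
next
  case False
  then obtain j where "k = 2 * j + 1" by (metis oddE)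
  then show ?thesis
    using normal_moment_odd[of 1 0 j] by (simp add: moment_def mult.commute)
qed

lemma has_bochner_integral_prod_gauss:
  fixes \<phi> :: "'n::finite \<Rightarrow> real \<Rightarrow> real"
  assumes "\<And>i. has_bochner_integral lborel (\<lambda>t. \<phi> i t * std_normal_density t) (I i)"
  shows "has_bochner_integral lborel (\<lambda>x::real^'n. (\<Prod>i\<in>UNIV. \<phi> i (x $ i)) * gauss x) (\<Prod>i\<in>UNIV. I i)"
  using has_bochner_integral_prod_vec[OF assms] by (simp add: gauss_def prod.distrib)

text \<open>For \<open>n \<le> 3\<close> the monic Hermite polynomials, orthogonal for the standard
  normal density. Beyond degree 3 the plain power is only a default value.\<close>

definition hermite :: "nat \<Rightarrow> real \<Rightarrow> real" where
  "hermite n t = (if n = 2 then t\<^sup>2 - 1 else if n = 3 then t ^ 3 - 3 * t else t ^ n)"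

definition hermite_moment :: "nat \<Rightarrow> nat \<Rightarrow> real" where
  "hermite_moment n k = (if n = 2 then moment (k + 2) - moment k
     else if n = 3 then moment (k + 3) - 3 * moment (k + 1) else moment (k + n))"

lemma has_bochner_integral_hermite_moment:
  "has_bochner_integral lborel (\<lambda>t. (t ^ k * hermite n t) * std_normal_density t) (hermite_moment n k)"
proof -
  note m = has_bochner_integral_moment
  consider "n = 2" | "n = 3" | "n \<noteq> 2" "n \<noteq> 3" by blast
  then show ?thesis
  proof cases
    case 1
    then show ?thesis
      using has_bochner_integral_diff[OF m[of "k + 2"] m[of k]]
      by (simp add: hermite_def hermite_moment_def power_add power2_eq_square algebra_simps)
  next
    case 2
    then show ?thesis
      using has_bochner_integral_diff[OF m[of "k + 3"] has_bochner_integral_mult_right[OF m[of "k + 1"], of 3]]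
      by (simp add: hermite_def hermite_moment_def power_add algebra_simps)
  next
    case 3
    then show ?thesis
      using m[of "k + n"]
      by (simp add: hermite_def hermite_moment_def power_add algebra_simps)
  qed
qed

lemma has_bochner_integral_hermite_square:
  assumes "n \<le> 3"
  shows "has_bochner_integral lborel (\<lambda>t. (hermite n t)\<^sup>2 * std_normal_density t) (fact n)"
proof -
  note m = has_bochner_integral_hermite_moment
  consider "n = 0" | "n = 1" | "n = 2" | "n = 3" using assms by linarith
  then show ?thesis
  proof cases
    case 1
    then show ?thesis using m[of 0 0] by (simp add: hermite_def hermite_moment_def)
  next
    case 2
    then show ?thesis using m[of 1 1] by (simp add: hermite_def hermite_moment_def power2_eq_square)
  next
    case 3
    then show ?thesis
      using has_bochner_integral_diff[OF m[of 2 2] m[of 0 2]]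
      by (simp add: hermite_def hermite_moment_def power2_eq_square algebra_simps)
  next
    case 4
    then show ?thesis
      using has_bochner_integral_diff[OF m[of 3 3] has_bochner_integral_mult_right[OF m[of 1 3], of 3]]
      by (simp add: hermite_def hermite_moment_def power2_eq_square algebra_simps fact_numeral)
  qed
qed

lemma hermite_moment_diag: "n \<le> 3 \<Longrightarrow> hermite_moment n n = fact n"
proof -
  assume "n \<le> 3"
  then have "n = 0 \<or> n = 1 \<or> n = 2 \<or> n = 3" by linarith
  then show ?thesis by (auto simp: hermite_moment_def fact_numeral)
qed

lemma hermite_moment_less: "k < n \<Longrightarrow> n \<le> 3 \<Longrightarrow> hermite_moment n k = 0"
proof -
  assume "k < n" "n \<le> 3"
  then have "n = 1 \<and> k = 0 \<or> n = 2 \<and> k = 0 \<or> n = 2 \<and> k = 1 \<or> n = 3 \<and> k = 0 \<or> n = 3 \<and> k = 1 \<or> n = 3 \<and> k = 2"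
    by linarith
  then show ?thesis by (auto simp: hermite_moment_def)
qed

section \<open>Monomials, and coefficients bounded by the norm\<close>

abbreviation monomial_value :: "('n::finite \<Rightarrow>\<^sub>0 nat) \<Rightarrow> 'a::real_field ^ 'n \<Rightarrow> 'a" where
  "monomial_value m x \<equiv> \<Prod>i\<in>UNIV. (x $ i) ^ Poly_Mapping.lookup m i"

lemma monomial_value_single: "monomial_value (Poly_Mapping.single i 1) x = x $ i"
proof -
  have "monomial_value (Poly_Mapping.single i 1) x = (\<Prod>j\<in>UNIV. if j = i then x $ j else 1)"
    by (intro prod.cong) (auto simp: lookup_single when_def)
  then show ?thesis by simp
qed

lemma monomial_value_add: "monomial_value (m + n) x = monomial_value m x * monomial_value n x"
  by (simp add: lookup_add power_add prod.distrib)

lemma integrable_eval_square: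
  fixes p :: "'n::finite rpoly"
  shows "integrable lborel (\<lambda>x. eval p x * eval p x * gauss x)"
proof -
  have "integrable lborel (\<lambda>x. (\<Prod>i\<in>UNIV. (x $ i) ^ (Poly_Mapping.lookup m i + Poly_Mapping.lookup n i)) * gauss x)"
    for m n :: "'n \<Rightarrow>\<^sub>0 nat"
    by (rule integrable.intros[OF has_bochner_integral_prod_gauss[OF has_bochner_integral_moment]])
  then have i: "integrable lborel (\<lambda>x. monomial_value m x * monomial_value n x * gauss x)" for m n :: "'n \<Rightarrow>\<^sub>0 nat"
    by (simp add: power_add prod.distrib)
  have "eval p x * eval p x * gauss x = (\<Sum>m\<in>Poly_Mapping.keys p. \<Sum>n\<in>Poly_Mapping.keys p.
      (Poly_Mapping.lookup p m * Poly_Mapping.lookup p n) * (monomial_value m x * monomial_value n x * gauss x))" for x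
    unfolding eval_def sum_product by (simp add: sum_distrib_left mult_ac)
  then show ?thesis
    by (simp only:) (intro Bochner_Integration.integrable_sum integrable_mult_right i)
qed

text \<open>Among the monomials of degree 3, only \<open>m\<close> has nonzero scalar product with the Hermite
  polynomial of exponent \<open>m\<close>.\<close>
lemma coefficient_le_inner_L2:
  assumes p: "p \<in> W" and m: "m \<in> Poly_Mapping.keys p"
  shows "(Poly_Mapping.lookup p m)\<^sup>2 \<le> inner_L2 p p"
proof -
  let ?l = "Poly_Mapping.lookup" and ?K = "Poly_Mapping.keys p"
  have deg: "(\<Sum>i\<in>UNIV. ?l k i) = 3" if "k \<in> ?K" for k
    using p that by (simp add: forms_def)
  have le3: "?l m i \<le> 3" for i
    using member_le_sum[of i UNIV "?l m"] deg[OF m] by simp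
  define H where "H x = (\<Prod>i\<in>UNIV. hermite (?l m i) (x $ i))" for x :: "real^4"
  define G :: real where "G = (\<Prod>i\<in>UNIV. fact (?l m i))"
  have G: "G \<ge> 1" unfolding G_def by (intro prod_ge_1) (simp add: fact_ge_1)
  have HH: "has_bochner_integral lborel (\<lambda>x. (H x)\<^sup>2 * gauss x) G"
    using has_bochner_integral_prod_gauss[OF has_bochner_integral_hermite_square[OF le3]]
    by (simp add: H_def G_def prod_power_distrib)
  have kH: "has_bochner_integral lborel (\<lambda>x. monomial_value k x * H x * gauss x)
      (\<Prod>i\<in>UNIV. hermite_moment (?l m i) (?l k i))" for k
    using has_bochner_integral_prod_gauss[OF has_bochner_integral_hermite_moment,
        of "?l k" "?l m"]
    by (simp add: H_def prod.distrib)
  have v: "(\<Prod>i\<in>UNIV. hermite_moment (?l m i) (?l k i)) = (if k = m then G else 0)"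
    if k: "k \<in> ?K" for k
  proof (cases "k = m")
    case True
    then show ?thesis by (simp add: G_def hermite_moment_diag le3)
  next
    case False
    \<comment> \<open>Two distinct exponents of equal degree cannot be comparable. In a coordinate
      where \<open>k\<close> is smaller, the Hermite factor is orthogonal to the power.\<close>
    have "\<exists>i. ?l k i < ?l m i"
    proof (rule ccontr)
      assume "\<not> ?thesis"
      then have ge: "?l m i \<le> ?l k i" for i by (simp add: not_less)
      obtain j where "?l m j \<noteq> ?l k j" using False using poly_mapping_eqI[of m k] by metis
      then have "?l m j < ?l k j" using ge[of j] by simp
      then have "sum (?l m) UNIV < sum (?l k) UNIV"
        using ge by (intro sum_strict_mono_ex1) auto
      then show False using deg[OF k] deg[OF m] by simp
    qed
    then obtain i where "?l k i < ?l m i" ..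
    then have "hermite_moment (?l m i) (?l k i) = 0"
      by (rule hermite_moment_less) (rule le3)
    then show ?thesis using False by (auto simp: prod_zero_iff)
  qed
  define c where "c = ?l p m"
  have pH: "has_bochner_integral lborel (\<lambda>x. eval p x * H x * gauss x) (c * G)"
  proof -
    have "has_bochner_integral lborel (\<lambda>x. \<Sum>k\<in>?K. ?l p k * (monomial_value k x * H x * gauss x))
       (\<Sum>k\<in>?K. ?l p k * (if k = m then G else 0))"
    proof (intro has_bochner_integral_sum has_bochner_integral_mult_right)
      fix k assume "k \<in> ?K"
      then show "has_bochner_integral lborel (\<lambda>x. monomial_value k x * H x * gauss x) (if k = m then G else 0)"
        using kH[of k] v[of k] by simp
    qed
    moreover have "(\<Sum>k\<in>?K. ?l p k * (if k = m then G else 0)) = c * G"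
      using m by (simp add: c_def if_distrib sum.delta cong: if_cong)
    moreover have "(\<lambda>x. \<Sum>k\<in>?K. ?l p k * (monomial_value k x * H x * gauss x)) = (\<lambda>x. eval p x * H x * gauss x)"
      by (simp add: eval_def sum_distrib_left mult_ac)
    ultimately show ?thesis by simp
  qed
  have pp: "has_bochner_integral lborel (\<lambda>x. eval p x * eval p x * gauss x) (inner_L2 p p)"
    using integrable_eval_square[of p] by (simp add: has_bochner_integral_iff inner_L2_eq)
  \<comment> \<open>Bessel's inequality: the squared distance from \<open>p\<close> to
    \<open>c * H\<close> is nonnegative, and \<open>G\<close>, the squared norm of \<open>H\<close>,
    is at least 1.\<close>
  have "has_bochner_integral lborel (\<lambda>x. eval p x * eval p x * gauss x
      - 2 * c * (eval p x * H x * gauss x) + c\<^sup>2 * ((H x)\<^sup>2 * gauss x))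
      (inner_L2 p p - 2 * c * (c * G) + c\<^sup>2 * G)"
    by (intro has_bochner_integral_add has_bochner_integral_diff has_bochner_integral_mult_right pp pH HH)
  moreover have "eval p x * eval p x * gauss x
      - 2 * c * (eval p x * H x * gauss x) + c\<^sup>2 * ((H x)\<^sup>2 * gauss x)
     = (eval p x - c * H x)\<^sup>2 * gauss x" for x :: "real^4"
    by (simp add: power2_eq_square algebra_simps)
  ultimately have "has_bochner_integral lborel (\<lambda>x. (eval p x - c * H x)\<^sup>2 * gauss x) (inner_L2 p p - c\<^sup>2 * G)"
    by (simp add: power2_eq_square algebra_simps)
  then have "inner_L2 p p - c\<^sup>2 * G = (\<integral>x. (eval p x - c * H x)\<^sup>2 * gauss x \<partial>lborel)"
    by (simp add: has_bochner_integral_iff)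
  also have "\<dots> \<ge> 0"
    by (intro Bochner_Integration.integral_nonneg) (simp add: gauss_nonneg)
  finally have "0 \<le> inner_L2 p p - c\<^sup>2 * G" .
  moreover have "c\<^sup>2 * 1 \<le> c\<^sup>2 * G" using G by (intro mult_left_mono) auto
  ultimately show ?thesis by (simp add: c_def)
qed

section \<open>Evaluation as a ring homomorphism\<close>

lemma eval_superset:
  assumes "finite A" "Poly_Mapping.keys p \<subseteq> A"
  shows "eval p x = (\<Sum>m\<in>A. of_real (Poly_Mapping.lookup p m) * monomial_value m x)"
  unfolding eval_def
  by (rule sum.mono_neutral_left) (use assms in \<open>auto simp: in_keys_iff\<close>)

lemma eval_add: "eval (p + q) x = eval p x + eval q x"
proof -
  let ?A = "Poly_Mapping.keys p \<union> Poly_Mapping.keys q"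
  have "Poly_Mapping.keys (p + q) \<subseteq> ?A" by (rule Poly_Mapping.keys_add)
  then show ?thesis
    using eval_superset[of ?A "p + q" x] eval_superset[of ?A p x] eval_superset[of ?A q x]
    by (simp add: lookup_add algebra_simps sum.distrib)
qed

lemma eval_zero [simp]: "eval 0 x = 0"
  by (simp add: eval_def)

lemma eval_sum: "eval (\<Sum>i\<in>A. f i) x = (\<Sum>i\<in>A. eval (f i) x)"
  by (induction A rule: infinite_finite_induct) (simp_all add: eval_add)

lemma eval_single: "eval (Poly_Mapping.single m c) x = of_real c * monomial_value m x"
  by (simp add: eval_def)

lemma sum_of_monomials:
  fixes p :: "'k \<Rightarrow>\<^sub>0 'a::comm_monoid_add"
  shows "p = (\<Sum>m\<in>Poly_Mapping.keys p. Poly_Mapping.single m (Poly_Mapping.lookup p m))"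
proof (rule poly_mapping_eqI)
  fix k
  show "Poly_Mapping.lookup p k
      = Poly_Mapping.lookup (\<Sum>m\<in>Poly_Mapping.keys p. Poly_Mapping.single m (Poly_Mapping.lookup p m)) k"
    by (simp add: lookup_sum lookup_single when_def in_keys_iff)
qed

lemma eval_mult: "eval (p * q) x = eval p x * eval q x"
proof -
  let ?l = "Poly_Mapping.lookup"
  note r = sum_of_monomials
  have "p * q = (\<Sum>m\<in>Poly_Mapping.keys p. \<Sum>n\<in>Poly_Mapping.keys q.
      Poly_Mapping.single (m + n) (?l p m * ?l q n))"
    by (subst r[of p], subst r[of q]) (simp add: sum_product mult_single)
  also have "eval \<dots> x = (\<Sum>m\<in>Poly_Mapping.keys p. \<Sum>n\<in>Poly_Mapping.keys q.
      (of_real (?l p m) * monomial_value m x) * (of_real (?l q n) * monomial_value n x))"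
    by (simp add: eval_sum eval_single lookup_add power_add prod.distrib mult_ac)
  also have "\<dots> = eval p x * eval q x"
    by (simp add: eval_def sum_product)
  finally show ?thesis .
qed

lemma eval_X [simp]: "eval (X i) x = x $ i"
  by (simp only: X_def eval_single monomial_value_single of_real_1 mult_1)

lemma eval_const [simp]: "eval (const c) x = of_real c"
  by (simp add: const_def eval_single)

section \<open>The cubics \<open>h1 a\<close> and their norm\<close>

lemma eval_h1: "eval (h1 a) x = (\<Sum>i\<in>UNIV. (x $ i)\<^sup>2) * (\<Sum>i\<in>UNIV. of_real (a $ i) * x $ i)"
  by (simp add: h1_def eval_mult eval_sum power2_eq_square)

lemma inner_L2_h1: "inner_L2 (h1 a) (h1 a) = 48 * (\<Sum>i\<in>UNIV. (a $ i)\<^sup>2)"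
proof -
  \<comment> \<open>The exponent vector of
    \<open>(x $ i)\<^sup>2 * (x $ j)\<^sup>2 * x $ k * x $ l\<close>, the general term in the
    expansion of the square of \<open>h1 a\<close>.\<close>
  define e :: "4 \<Rightarrow> 4 \<Rightarrow> 4 \<Rightarrow> 4 \<Rightarrow> 4 \<Rightarrow> nat" where
    "e i j k l n = (if n = i then 2 else 0) + (if n = j then 2 else 0)
       + (if n = k then 1 else 0) + (if n = l then 1 else 0)" for i j k l n
  have mono: "(\<Prod>n\<in>UNIV. (x $ n) ^ e i j k l n) = (x $ i)\<^sup>2 * (x $ j)\<^sup>2 * x $ k * x $ l"
    for i j k l and x :: "real^4"
  proof -
    have d: "(\<Prod>n\<in>UNIV. (x $ n) ^ (if n = i then c else 0)) = (x $ i) ^ c" for i :: 4 and c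
    proof -
      have "(\<Prod>n\<in>UNIV. (x $ n) ^ (if n = i then c else 0)) = (\<Prod>n\<in>UNIV. if n = i then (x $ n) ^ c else 1)"
        by (intro prod.cong) auto
      then show ?thesis by simp
    qed
    show ?thesis unfolding e_def power_add prod.distrib d by simp
  qed
  have "has_bochner_integral lborel
     (\<lambda>x::real^4. \<Sum>i\<in>UNIV. \<Sum>j\<in>UNIV. \<Sum>k\<in>UNIV. \<Sum>l\<in>UNIV. (a $ k * a $ l) * ((\<Prod>n\<in>UNIV. (x $ n) ^ e i j k l n) * gauss x))
     (\<Sum>i\<in>UNIV. \<Sum>j\<in>UNIV. \<Sum>k\<in>UNIV. \<Sum>l\<in>UNIV. (a $ k * a $ l) * (\<Prod>n\<in>UNIV. moment (e i j k l n)))"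
    by (intro has_bochner_integral_sum has_bochner_integral_mult_right
        has_bochner_integral_prod_gauss has_bochner_integral_moment)
  moreover have "(\<Sum>i\<in>UNIV. \<Sum>j\<in>UNIV. \<Sum>k\<in>UNIV. \<Sum>l\<in>UNIV.
      (a $ k * a $ l) * ((\<Prod>n\<in>UNIV. (x $ n) ^ e i j k l n) * gauss x))
     = eval (h1 a) x * eval (h1 a) x * gauss x" for x :: "real^4"
  proof -
    have "(a $ k * a $ l) * ((\<Prod>n\<in>UNIV. (x $ n) ^ e i j k l n) * gauss x)
      = (x $ i)\<^sup>2 * ((x $ j)\<^sup>2 * ((a $ k * x $ k) * ((a $ l * x $ l) * gauss x)))" for i j k l
      unfolding mono by (simp only: mult_ac)
    then show ?thesis
      unfolding eval_h1 by (simp only: sum_distrib_left[symmetric] sum_distrib_right[symmetric])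
        (simp only: of_real_eq_id id_apply mult_ac)
  qed
  moreover have "(\<Sum>i\<in>UNIV. \<Sum>j\<in>UNIV. \<Sum>k\<in>UNIV. \<Sum>l\<in>UNIV. (a $ k * a $ l) * (\<Prod>n\<in>UNIV. moment (e i j k l n)))
     = 48 * (\<Sum>k\<in>UNIV. (a $ k)\<^sup>2)"
  proof -
    let ?M = "\<lambda>i j k l. \<Prod>n\<in>UNIV. moment (e i j k l n)"
    have off: "?M i j k l = 0" if "k \<noteq> l" for i j k l
    proof -
      have "odd (e i j k l k)" using that by (simp add: e_def)
      then have "moment (e i j k l k) = 0" by (simp add: moment_def)
      then show ?thesis by (auto simp: prod_zero_iff)
    qed
    \<comment> \<open>This is the Gaussian mean of \<open>(norm x) ^ 4 * (x $ k)\<^sup>2\<close>,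
      that is, a quarter of the mean \<open>4 * 6 * 8\<close> of
      \<open>(norm x) ^ 6\<close>.\<close>
    have "(\<Sum>i\<in>UNIV. \<Sum>j\<in>UNIV. ?M i j k k) = 48" for k
    proof -
      have neq: "(1::4) \<noteq> 2" "(1::4) \<noteq> 3" "(1::4) \<noteq> 4" "(2::4) \<noteq> 3" "(2::4) \<noteq> 4" "(3::4) \<noteq> 4"
        by simp_all
      have prod_4: "prod f (UNIV :: 4 set) = f 1 * f 2 * f 3 * f 4" for f :: "4 \<Rightarrow> real"
        unfolding UNIV_4 by (simp add: ac_simps)
      have "\<forall>k. (\<Sum>i\<in>UNIV. \<Sum>j\<in>UNIV. ?M i j k k) = 48"
        unfolding forall_4 sum_4 prod_4 e_def by (simp add: neq neq[symmetric])
      then show ?thesis ..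
    qed
    moreover have "(\<Sum>l\<in>UNIV. (a $ k * a $ l) * ?M i j k l) = (a $ k)\<^sup>2 * ?M i j k k" for i j k
    proof -
      have "(\<Sum>l\<in>UNIV. (a $ k * a $ l) * ?M i j k l) = (\<Sum>l\<in>{k}. (a $ k * a $ l) * ?M i j k l)"
        by (rule sum.mono_neutral_right) (auto simp: off)
      then show ?thesis by (simp add: power2_eq_square)
    qed
    moreover have "(\<Sum>i\<in>UNIV. \<Sum>j\<in>UNIV. \<Sum>k\<in>UNIV. (a $ k)\<^sup>2 * ?M i j k k)
      = (\<Sum>k\<in>UNIV. (a $ k)\<^sup>2 * (\<Sum>i\<in>UNIV. \<Sum>j\<in>UNIV. ?M i j k k))"
    proof -
      have "(\<Sum>i\<in>UNIV. \<Sum>j\<in>UNIV. \<Sum>k\<in>UNIV. (a $ k)\<^sup>2 * ?M i j k k)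
        = (\<Sum>i\<in>UNIV. \<Sum>k\<in>UNIV. \<Sum>j\<in>UNIV. (a $ k)\<^sup>2 * ?M i j k k)"
        by (intro sum.cong refl sum.swap)
      also have "\<dots> = (\<Sum>k\<in>UNIV. \<Sum>i\<in>UNIV. \<Sum>j\<in>UNIV. (a $ k)\<^sup>2 * ?M i j k k)"
        by (rule sum.swap)
      finally show ?thesis by (simp only: sum_distrib_left)
    qed
    ultimately show ?thesis by (simp only:) (simp add: sum_distrib_left mult.commute)
  qed
  ultimately show ?thesis
    by (simp add: inner_L2_eq has_bochner_integral_iff)
qed

section \<open>The polar form of a cubic\<close>

fun sym3 :: "'n \<times> 'n \<times> 'n \<Rightarrow> 'a::real_field ^ 'n \<Rightarrow> 'a ^ 'n \<Rightarrow> 'a ^ 'n \<Rightarrow> 'a" where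
  "sym3 (i, j, k) x y z = x$i * y$j * z$k + x$i * y$k * z$j + x$j * y$i * z$k
     + x$j * y$k * z$i + x$k * y$i * z$j + x$k * y$j * z$i"

definition monomial_of :: "'n \<times> 'n \<times> 'n \<Rightarrow> 'n \<Rightarrow>\<^sub>0 nat" where
  "monomial_of = (\<lambda>(i, j, k). Poly_Mapping.single i 1 + Poly_Mapping.single j 1 + Poly_Mapping.single k 1)"

text \<open>Some ordering of the three variables in a monomial of degree 3; \<open>sym3\<close>
  takes the same value for all orderings. For other degrees the value is arbitrary.\<close>

definition indices :: "('n \<Rightarrow>\<^sub>0 nat) \<Rightarrow> 'n \<times> 'n \<times> 'n" where
  "indices m = (SOME t. monomial_of t = m)"

text \<open>The symmetric trilinear form with the cubic as its diagonal. It is defined over any real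
  field so that it can be evaluated at real and at complex points.\<close>

definition polar :: "'n::finite rpoly \<Rightarrow> 'a::real_field ^ 'n \<Rightarrow> 'a ^ 'n \<Rightarrow> 'a ^ 'n \<Rightarrow> 'a" where
  "polar p x y z = (\<Sum>m\<in>Poly_Mapping.keys p.
     of_real (Poly_Mapping.lookup p m) / 6 * sym3 (indices m) x y z)"

lemma degree_Suc_split:
  fixes m :: "'n::finite \<Rightarrow>\<^sub>0 nat"
  assumes "(\<Sum>i\<in>UNIV. Poly_Mapping.lookup m i) = Suc d"
  obtains i m' where "m = m' + Poly_Mapping.single i 1" "(\<Sum>i\<in>UNIV. Poly_Mapping.lookup m' i) = d"
proof -
  obtain i where i: "Poly_Mapping.lookup m i \<noteq> 0"
    using assms by (metis nat.distinct(1) sum.neutral)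
  define m' where "m' = m - Poly_Mapping.single i 1"
  have m: "m = m' + Poly_Mapping.single i 1"
    using i by (intro poly_mapping_eqI) (auto simp: m'_def lookup_add lookup_minus lookup_single when_def)
  have "(\<Sum>j\<in>UNIV. Poly_Mapping.lookup m j) = (\<Sum>j\<in>UNIV. Poly_Mapping.lookup m' j) + 1"
    by (subst m) (simp add: lookup_add sum.distrib lookup_single when_def)
  then show ?thesis using that[OF m] assms by simp
qed

lemma monomial_of_indices:
  fixes m :: "'n::finite \<Rightarrow>\<^sub>0 nat"
  assumes "(\<Sum>i\<in>UNIV. Poly_Mapping.lookup m i) = 3"
  shows "monomial_of (indices m) = m"
proof -
  obtain i m1 where 1: "m = m1 + Poly_Mapping.single i 1" "(\<Sum>i\<in>UNIV. Poly_Mapping.lookup m1 i) = 2"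
    by (rule degree_Suc_split[of m 2]) (use assms in auto)
  obtain j m2 where 2: "m1 = m2 + Poly_Mapping.single j 1" "(\<Sum>i\<in>UNIV. Poly_Mapping.lookup m2 i) = 1"
    by (rule degree_Suc_split[of m1 1]) (use 1(2) in auto)
  obtain k m3 where 3: "m2 = m3 + Poly_Mapping.single k 1" "(\<Sum>i\<in>UNIV. Poly_Mapping.lookup m3 i) = 0"
    by (rule degree_Suc_split[of m2 0]) (use 2(2) in auto)
  have "m3 = 0" using 3(2) by (intro poly_mapping_eqI) simp
  then have "monomial_of (k, j, i) = m" by (simp add: monomial_of_def 1(1) 2(1) 3(1))
  then show ?thesis unfolding indices_def by (rule someI)
qed

lemma sym3_diag: "sym3 t x x x = 6 * monomial_value (monomial_of t) x"
  by (cases t) (simp only: monomial_of_def prod.case monomial_value_add monomial_value_single, simp)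

text \<open>The product rule for a monomial in three variables. If variable \<open>l\<close> does
  not occur, both sides vanish, whatever the truncated subtraction yields.\<close>

lemma sym3_axis:
  "of_nat (Poly_Mapping.lookup (monomial_of t) l) * monomial_value (monomial_of t - Poly_Mapping.single l 1) x
     = sym3 t x x (axis l 1) / 2"
proof -
  let ?s = "\<lambda>i. Poly_Mapping.single i (1::nat)"
  obtain i j k where t: "t = (i, j, k)" by (cases t)
  have r: "sym3 t x x (axis l 1) / 2 = (if k = l then x$i * x$j else 0) + (if j = l then x$i * x$k else 0)
      + (if i = l then x$j * x$k else 0)"
    unfolding t by (simp add: axis_def)
  have L: "Poly_Mapping.lookup (monomial_of t) l = (if i = l then 1 else 0) + (if j = l then 1 else 0)
      + (if k = l then 1 else 0)"
    unfolding t by (simp add: monomial_of_def lookup_add lookup_single when_def)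
  have d: "monomial_of t - ?s i = ?s j + ?s k" "monomial_of t - ?s j = ?s i + ?s k"
    "monomial_of t - ?s k = ?s i + ?s j"
    unfolding t monomial_of_def
    by (auto intro!: poly_mapping_eqI simp: lookup_add lookup_minus)
  consider "i = l" | "i \<noteq> l" "j = l" | "i \<noteq> l" "j \<noteq> l" "k = l" | "i \<noteq> l" "j \<noteq> l" "k \<noteq> l" by blast
  then show ?thesis
  proof cases
    case 1
    have "monomial_value (monomial_of t - ?s l) x = x$j * x$k"
      unfolding 1[symmetric] d monomial_value_add monomial_value_single ..
    then show ?thesis unfolding r L using 1 by auto
  next
    case 2
    have "monomial_value (monomial_of t - ?s l) x = x$i * x$k"
      unfolding 2(2)[symmetric] d monomial_value_add monomial_value_single ..
    then show ?thesis unfolding r L using 2 by auto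
  next
    case 3
    have "monomial_value (monomial_of t - ?s l) x = x$i * x$j"
      unfolding 3(3)[symmetric] d monomial_value_add monomial_value_single ..
    then show ?thesis unfolding r L using 3 by auto
  next
    case 4
    then show ?thesis unfolding r L by simp
  qed
qed

lemma forms_degree: "p \<in> forms d \<Longrightarrow> m \<in> Poly_Mapping.keys p \<Longrightarrow> (\<Sum>i\<in>UNIV. Poly_Mapping.lookup m i) = d"
  by (simp add: forms_def)

lemma eval_eq_polar: "p \<in> forms 3 \<Longrightarrow> eval p x = polar p x x x"
  unfolding eval_def polar_def
  by (intro sum.cong) (simp_all add: sym3_diag monomial_of_indices forms_degree)

lemma eval_partial_deriv:
  assumes "p \<in> forms 3"
  shows "eval (partial_deriv l p) x = 3 * polar p x x (axis l 1)"
proof -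
  have "eval (partial_deriv l p) x = (\<Sum>m\<in>Poly_Mapping.keys p. of_real (Poly_Mapping.lookup p m) *
      (of_nat (Poly_Mapping.lookup m l) * monomial_value (m - Poly_Mapping.single l 1) x))"
    unfolding partial_deriv_def by (simp add: eval_sum eval_single mult_ac)
  also have "\<dots> = (\<Sum>m\<in>Poly_Mapping.keys p. of_real (Poly_Mapping.lookup p m) *
      (sym3 (indices m) x x (axis l 1) / 2))"
  proof (intro sum.cong refl)
    fix m assume "m \<in> Poly_Mapping.keys p"
    then have "monomial_of (indices m) = m" by (intro monomial_of_indices forms_degree[OF assms])
    then have "of_nat (Poly_Mapping.lookup m l) * monomial_value (m - Poly_Mapping.single l 1) x
        = sym3 (indices m) x x (axis l 1) / 2"
      using sym3_axis[of "indices m" l x] by (simp only:)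
    then show "of_real (Poly_Mapping.lookup p m) *
        (of_nat (Poly_Mapping.lookup m l) * monomial_value (m - Poly_Mapping.single l 1) x)
      = of_real (Poly_Mapping.lookup p m) * (sym3 (indices m) x x (axis l 1) / 2)"
      by (simp only:)
  qed
  also have "\<dots> = 3 * polar p x x (axis l 1)"
    unfolding polar_def sum_distrib_left by (intro sum.cong) simp_all
  finally show ?thesis .
qed

lemma sym3_swap12: "sym3 t x y z = sym3 t y x z"
  and sym3_swap23: "sym3 t x y z = sym3 t x z y"
  and sym3_add: "sym3 t (x + x') y z = sym3 t x y z + sym3 t x' y z"
  and sym3_scale: "sym3 t (c *s x) y z = c * sym3 t x y z"
  by (cases t; simp add: algebra_simps)+

lemma trilinear_form_polar: "trilinear_form (polar p :: real^'n::finite \<Rightarrow> _)"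
proof
  fix x x' y z :: "real^'n" and c :: real
  show "polar p x y z = polar p y x z"
    unfolding polar_def by (simp only: sym3_swap12)
  show "polar p x y z = polar p x z y"
    unfolding polar_def by (simp only: sym3_swap23)
  show "polar p (x + x') y z = polar p x y z + polar p x' y z"
    unfolding polar_def by (simp add: sym3_add algebra_simps sum.distrib)
  have "c *\<^sub>R x = c *s x" by (simp add: vec_eq_iff)
  then show "polar p (c *\<^sub>R x) y z = c * polar p x y z"
    unfolding polar_def by (simp add: sym3_scale sum_distrib_left mult_ac)
qed

lemma polar_scale12: "polar p (c *s x) (c *s y) z = c\<^sup>2 * polar p x y z"
proof -
  have "sym3 t (c *s x) (c *s y) z = c\<^sup>2 * sym3 t x y z" for t
    by (cases t) (simp add: algebra_simps power2_eq_square)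
  then show ?thesis unfolding polar_def by (simp add: sum_distrib_left mult_ac)
qed

section \<open>Complex singular points and the discriminant\<close>

definition complex_vec :: "real^'n \<Rightarrow> real^'n \<Rightarrow> complex^'n" where
  "complex_vec x y = (\<chi> i. Complex (x $ i) (y $ i))"

lemma polar_complex_vec:
  "polar p (complex_vec x y) (complex_vec x y) (axis l 1)
    = Complex (polar p x x (axis l 1) - polar p y y (axis l 1)) (2 * polar p x y (axis l 1))"
proof -
  have a: "(axis l 1 :: complex^'a) $ i = of_real ((axis l 1 :: real^'a) $ i)" for i
    by (simp add: axis_def)
  have s: "sym3 t (complex_vec x y) (complex_vec x y) (axis l 1)
    = Complex (sym3 t x x (axis l 1) - sym3 t y y (axis l 1)) (2 * sym3 t x y (axis l 1))" for t
  proof -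
    obtain i j k where t: "t = (i, j, k)" by (cases t)
    show ?thesis unfolding t sym3.simps a
      by (simp add: complex_eq_iff complex_vec_def algebra_simps)
  qed
  show ?thesis
    unfolding polar_def s
    by (simp add: complex_eq_iff sum_subtractf[symmetric] sum_distrib_left algebra_simps diff_divide_distrib)
qed

lemma proj_space_span:
  fixes x :: "'a::field ^ 'n::finite"
  assumes "x \<noteq> 0"
  shows "vec.span {x} \<in> proj_space"
  using assms by (simp add: proj_space_def vec.dim_eq_card_independent)

text \<open>By the hypotheses the real and imaginary parts of every partial derivative vanish at the
  complex vector \<open>p + i q\<close>; homogeneity extends this to the projective point that it
  spans.\<close>

lemma mem_complex_discriminant:
  assumes g: "g \<in> W" and nz: "p \<noteq> 0 \<or> q \<noteq> 0"
    and pq: "\<And>y. polar g p p y = polar g q q y" "\<And>y. polar g p q y = (0::real)"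
  shows "g \<in> complex_discriminant"
proof -
  let ?z = "complex_vec p q"
  have "?z \<noteq> 0" using nz by (auto simp: complex_vec_def vec_eq_iff complex_eq_iff)
  moreover have "eval (partial_deriv l g) x = 0" if "x \<in> vec.span {?z}" for l x
  proof -
    obtain c where x: "x = c *s ?z" using \<open>x \<in> vec.span {?z}\<close> by (auto simp: vec.span_singleton)
    show ?thesis
      unfolding eval_partial_deriv[OF g] x polar_scale12 polar_complex_vec pq
      by (simp add: complex_eq_iff)
  qed
  ultimately have "vec.span {?z} \<in> proj_zeros {partial_deriv i g | i. True}"
    using proj_space_span by (auto simp: proj_zeros_def)
  then show ?thesis using g unfolding complex_discriminant_def by blast
qed

section \<open>Degrees of forms, and positivity of the polar form near \<open>h1 a\<close>\<close>

lemma forms_add: "p \<in> forms d \<Longrightarrow> q \<in> forms d \<Longrightarrow> p + q \<in> forms d"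
  using Poly_Mapping.keys_add[of p q] by (auto simp: forms_def)

lemma forms_diff: "p \<in> forms d \<Longrightarrow> q \<in> forms d \<Longrightarrow> p - q \<in> forms d"
  using Poly_Mapping.keys_diff[of p q] by (auto simp: forms_def)

lemma zero_in_forms: "0 \<in> forms d"
  by (simp add: forms_def)

lemma forms_sum: "(\<And>i. i \<in> A \<Longrightarrow> f i \<in> forms d) \<Longrightarrow> sum f A \<in> forms d"
  by (induction A rule: infinite_finite_induct) (auto intro: forms_add zero_in_forms)

lemma forms_mult: "p \<in> forms c \<Longrightarrow> q \<in> forms d \<Longrightarrow> p * q \<in> forms (c + d)"
  using Poly_Mapping.keys_mult[of p q]
  by (fastforce simp: forms_def lookup_add sum.distrib)

lemma X_in_forms: "X i \<in> forms 1"
  by (simp add: forms_def X_def lookup_single when_def)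

lemma const_in_forms: "const c \<in> forms 0"
  by (simp add: forms_def const_def)

lemma h1_in_W: "h1 a \<in> W"
proof -
  have "(\<Sum>i\<in>UNIV. (X i)\<^sup>2) * (\<Sum>i\<in>UNIV. const (a $ i) * X i) \<in> forms ((1 + 1) + (0 + 1))"
    unfolding power2_eq_square by (intro forms_mult forms_sum X_in_forms const_in_forms)
  then show ?thesis by (simp add: h1_def numeral_3_eq_3)
qed

text \<open>Each coefficient is at most the norm and each monomial at most \<open>r ^ 3\<close>.
  There are at most \<open>4 ^ 3 = 64\<close> monomials, since every one comes from a triple of
  indices.\<close>

lemma abs_eval_le:
  assumes p: "p \<in> W" and x: "norm x \<le> r"
  shows "\<bar>eval p x\<bar> \<le> 64 * norm_L2 p * r ^ 3"
proof -
  have r: "\<bar>x $ i\<bar> \<le> r" "0 \<le> r" for i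
    using component_le_norm_cart[of x i] x by (auto intro: order_trans[OF norm_ge_zero])
  have c: "\<bar>of_real (Poly_Mapping.lookup p m) * monomial_value m x\<bar> \<le> norm_L2 p * r ^ 3"
    if m: "m \<in> Poly_Mapping.keys p" for m
  proof -
    obtain i j k where t: "indices m = (i, j, k)" by (cases "indices m")
    have "6 * monomial_value m x = 6 * (x$i * x$j * x$k)"
      using sym3_diag[of "indices m" x] monomial_of_indices[OF forms_degree[OF p m]]
      unfolding t by simp
    then have e: "monomial_value m x = x$i * x$j * x$k" by simp
    have "\<bar>monomial_value m x\<bar> \<le> r * r * r"
      unfolding e abs_mult using r by (intro mult_mono) auto
    moreover have "\<bar>Poly_Mapping.lookup p m\<bar> \<le> norm_L2 p"
      unfolding norm_L2_def using coefficient_le_inner_L2[OF p m] by (simp add: real_le_rsqrt)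
    ultimately have "\<bar>Poly_Mapping.lookup p m\<bar> * \<bar>monomial_value m x\<bar> \<le> norm_L2 p * (r * r * r)"
      by (intro mult_mono) auto
    then show ?thesis by (simp add: abs_mult power3_eq_cube)
  qed
  have "Poly_Mapping.keys p \<subseteq> range monomial_of"
    using monomial_of_indices forms_degree[OF p] by (metis rangeI subsetI)
  then have "card (Poly_Mapping.keys p) \<le> card (UNIV :: (4 \<times> 4 \<times> 4) set)"
    by (meson card_image_le card_mono finite finite_imageI le_trans)
  then have k: "real (card (Poly_Mapping.keys p)) \<le> 64" by simp
  have n: "0 \<le> norm_L2 p * r ^ 3"
  proof (cases "p = 0")
    case True
    then show ?thesis by (simp add: norm_L2_def inner_L2_def)
  next
    case False
    then obtain m where "m \<in> Poly_Mapping.keys p" by (meson keys_eq_empty ex_in_conv)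
    then show ?thesis using c abs_ge_zero order_trans by blast
  qed
  have "\<bar>eval p x\<bar> \<le> real (card (Poly_Mapping.keys p)) * (norm_L2 p * r ^ 3)"
    unfolding eval_def by (rule order_trans[OF sum_abs sum_bounded_above[OF c]])
  also have "\<dots> \<le> 64 * (norm_L2 p * r ^ 3)"
    using k n by (intro mult_right_mono)
  finally show ?thesis by simp
qed

lemma norm_L2_h1: "(norm_L2 (h1 a))\<^sup>2 = 48 * (norm a)\<^sup>2"
proof -
  have "(norm a)\<^sup>2 = (\<Sum>i\<in>UNIV. (a $ i)\<^sup>2)"
    unfolding power2_norm_eq_inner inner_vec_def by (simp add: power2_eq_square)
  then show ?thesis
    by (simp add: norm_L2_def inner_L2_h1 sum_nonneg)
qed

lemma eval_h1_inner: "eval (h1 a) (x :: real^4) = (x \<bullet> x) * (a \<bullet> x)"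
  by (simp add: eval_h1 inner_vec_def power2_eq_square)

text \<open>For unit \<open>y\<close>, the contribution of \<open>h1 a\<close> to
  \<open>6 * polar g y y a\<close> is at least \<open>2 * (a \<bullet> a) = 1 / 24\<close>, which
  exceeds that of the small perturbation. Homogeneity gives all nonzero \<open>x\<close>.\<close>

lemma polar_pos:
  assumes a: "(norm_L2 (h1 a))\<^sup>2 = 1" and g: "g \<in> W" and \<epsilon>: "norm_L2 (g - h1 a) \<le> 1 / 100000"
    and x: "x \<noteq> 0"
  shows "polar g x x a > 0"
proof -
  interpret trilinear_form "polar g :: real^4 \<Rightarrow> _" by (rule trilinear_form_polar)
  have na: "48 * (norm a)\<^sup>2 = 1" using a norm_L2_h1 by simp
  then have aa: "a \<bullet> a = 1 / 48" by (simp add: power2_norm_eq_inner)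
  have "(norm a)\<^sup>2 \<le> 1\<^sup>2" using na by simp
  then have a1: "norm a \<le> 1" by (rule power2_le_imp_le) simp
  define d where "d = g - h1 a"
  have dW: "d \<in> W" unfolding d_def by (intro forms_diff g h1_in_W)
  \<comment> \<open>\<open>64 * 2 ^ 3 / 100000\<close> is below \<open>1 / 150\<close>. Four such
    errors enter the identity for \<open>6 * polar g y y a\<close>, and
    \<open>4 / 150 < 1 / 24\<close>.\<close>
  have small: "\<bar>eval d y\<bar> \<le> 1 / 150" if "norm y \<le> 2" for y :: "real^4"
    using abs_eval_le[OF dW that] \<epsilon> by (simp add: d_def)
  have unit: "polar g y y a > 0" if y: "norm y = 1" for y
  proof -
    have yy: "y \<bullet> y = 1" using y by (simp add: power2_norm_eq_inner[symmetric])
    have ev: "eval g z = (z \<bullet> z) * (a \<bullet> z) + eval d z" for z :: "real^4"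
      using eval_add[of d "h1 a" z] by (simp add: d_def eval_h1_inner)
    have "6 * polar g y y a = eval g (y + a) - eval g (y - a) - 2 * eval g a"
      unfolding eval_eq_polar[OF g] by (simp add: expand swaps)
    also have "\<dots> = 2 * (y \<bullet> y) * (a \<bullet> a) + 4 * (a \<bullet> y)\<^sup>2
        + (eval d (y + a) - eval d (y - a) - 2 * eval d a)"
      unfolding ev by (simp add: inner_add_left inner_add_right inner_diff_left inner_diff_right
          inner_commute algebra_simps power2_eq_square)
    also have "\<dots> \<ge> 1 / 24 - 4 / 150"
    proof -
      have n: "norm (y + a) \<le> 2" "norm (y - a) \<le> 2" "norm a \<le> 2"
        using a1 y norm_triangle_ineq[of y a] norm_triangle_ineq4[of y a] by linarith+
      have "0 \<le> (a \<bullet> y)\<^sup>2" by simp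
      then show ?thesis
        using small[OF n(1)] small[OF n(2)] small[OF n(3)] unfolding yy aa by linarith
    qed
    finally show ?thesis by simp
  qed
  have "polar g x x a = (norm x)\<^sup>2 * polar g ((1 / norm x) *\<^sub>R x) ((1 / norm x) *\<^sub>R x) a"
    using x by (simp add: scale1 scale2 power2_eq_square)
  also have "\<dots> > 0" using x by (intro mult_pos_pos unit) auto
  finally show ?thesis .
qed

text \<open>A plane is recovered from its projective points, because each of its nonzero vectors
  spans one of them. So passing from planes to their sets of points is a bijection onto the
  projective lines in the zero set.\<close>

lemma card_lines_eq_card_planes:
  assumes "g \<in> W"
  shows "card {L \<in> proj_lines. L \<subseteq> Z g}
    = card {V :: (real^4) set. subspace V \<and> dim V = 2 \<and> (\<forall>x\<in>V. polar g x x x = 0)}"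
proof -
  let ?line = "\<lambda>V :: (real^4) set. {P \<in> proj_space. P \<subseteq> V}"
  let ?A = "{V :: (real^4) set. subspace V \<and> dim V = 2 \<and> (\<forall>x\<in>V. polar g x x x = 0)}"
  have span: "vec.span {x} \<in> ?line V" "x \<in> vec.span {x}"
    if "subspace V" "x \<in> V" "x \<noteq> 0" for x V
  proof -
    have "span {x} \<subseteq> V" using that by (intro span_minimal) auto
    then show "vec.span {x} \<in> ?line V" using proj_space_span[OF that(3)] by (simp add: span_vec_eq)
    show "x \<in> vec.span {x}" by (simp add: vec.span_base)
  qed
  have inj: "V \<subseteq> V'" if "?line V = ?line V'" "subspace V" "subspace V'" for V V'
  proof
    fix x assume "x \<in> V"
    then show "x \<in> V'"
      using span[OF that(2), of x] that subspace_0[OF that(3)] by (cases "x = 0") blast+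
  qed
  have "{L \<in> proj_lines. L \<subseteq> Z g} = ?line ` ?A"
  proof (intro set_eqI iffI)
    fix L assume "L \<in> {L \<in> proj_lines. L \<subseteq> Z g}"
    then obtain V where V: "L = ?line V" "subspace V" "dim V = 2" "L \<subseteq> Z g"
      by (auto simp: proj_lines_def subspace_vec_eq dim_vec_eq)
    have "polar g x x x = 0" if "x \<in> V" for x
    proof (cases "x = 0")
      case True
      then show ?thesis using trilinear_form.zero1[OF trilinear_form_polar] by blast
    next
      case False
      then have "vec.span {x} \<in> Z g" "x \<in> vec.span {x}" using span[OF V(2) that] V(1,4) by blast+
      then show ?thesis
        unfolding eval_eq_polar[OF assms, symmetric] proj_zeros_def by blast
    qed
    then show "L \<in> ?line ` ?A" using V by blast
  next
    fix L assume "L \<in> ?line ` ?A"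
    then obtain V where V: "L = ?line V" "subspace V" "dim V = 2" "\<forall>x\<in>V. polar g x x x = 0"
      by blast
    then have "L \<in> proj_lines"
      unfolding proj_lines_def subspace_vec_eq dim_vec_eq by blast
    moreover have "L \<subseteq> Z g"
      using V(1,4) by (auto simp: proj_zeros_def eval_eq_polar[OF assms])
    ultimately show "L \<in> {L \<in> proj_lines. L \<subseteq> Z g}" by blast
  qed
  moreover have "inj_on ?line ?A"
  proof (rule inj_onI)
    fix V V' assume V: "V \<in> ?A" "V' \<in> ?A" and eq: "?line V = ?line V'"
    have "subspace V" "subspace V'" using V by simp_all
    then show "V = V'" using inj[OF eq] inj[OF eq[symmetric]] by (intro subset_antisym)
  qed
  ultimately show ?thesis by (simp add: card_image)
qed

theorem proposition6:
  shows "(\<forall>a. (norm_L2 (h1 a))\<^sup>2 = 48 * ((a $ 0)\<^sup>2 + (a $ 1)\<^sup>2 + (a $ 2)\<^sup>2 + (a $ 3)\<^sup>2)) \<and>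
    (\<exists>\<epsilon>>0. \<forall>a. (norm_L2 (h1 a))\<^sup>2 = 1 \<longrightarrow>
      (\<forall>g \<in> W - complex_discriminant. norm_L2 (g - h1 a) \<le> \<epsilon> \<longrightarrow>
        card {L \<in> proj_lines. L \<subseteq> Z g} = 3))"
proof (intro conjI allI)
  fix a :: "real^4"
  \<comment> \<open>In the index type \<open>4\<close> the numerals 4 and 0 coincide;
    \<open>sum_4\<close> runs over the indices 1 to 4.\<close>
  have "a $ 4 = a $ 0" by (rule arg_cong[of 4 0 "($) a"]) simp
  then show "(norm_L2 (h1 a))\<^sup>2 = 48 * ((a $ 0)\<^sup>2 + (a $ 1)\<^sup>2 + (a $ 2)\<^sup>2 + (a $ 3)\<^sup>2)"
    by (simp add: norm_L2_def inner_L2_h1 sum_nonneg sum_4)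
next
  have "card {L \<in> proj_lines. L \<subseteq> Z g} = 3"
    if "(norm_L2 (h1 a))\<^sup>2 = 1" "g \<in> W" "g \<notin> complex_discriminant"
      "norm_L2 (g - h1 a) \<le> 1 / 100000" for a g
  proof -
    interpret trilinear_form "polar g :: real^4 \<Rightarrow> _" by (rule trilinear_form_polar)
    interpret cubic_surface "polar g" a
    proof
      show "DIM(real^4) = 4" by simp
      show "polar g x x a > 0" if "x \<noteq> 0" for x
        using polar_pos that \<open>(norm_L2 (h1 a))\<^sup>2 = 1\<close> \<open>g \<in> W\<close> \<open>norm_L2 (g - h1 a) \<le> 1 / 100000\<close> by blast
      show "p = 0 \<and> q = 0"
        if "\<And>y. polar g p p y = polar g q q y" "\<And>y. polar g p q y = 0" for p q :: "real^4"
      proof (rule ccontr)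
        assume "\<not> (p = 0 \<and> q = 0)"
        then have "p \<noteq> 0 \<or> q \<noteq> 0" by blast
        then have "g \<in> complex_discriminant"
          by (rule mem_complex_discriminant[OF \<open>g \<in> W\<close>]) (rule that)+
        then show False using \<open>g \<notin> complex_discriminant\<close> by contradiction
      qed
    qed
    show ?thesis
      unfolding card_lines_eq_card_planes[OF \<open>g \<in> W\<close>] using card_zero_planes
      unfolding zero_planes_def .
  qed
  then show "\<exists>\<epsilon>>0. \<forall>a. (norm_L2 (h1 a))\<^sup>2 = 1 \<longrightarrow>
      (\<forall>g \<in> W - complex_discriminant. norm_L2 (g - h1 a) \<le> \<epsilon> \<longrightarrow>
        card {L \<in> proj_lines. L \<subseteq> Z g} = 3)"
    by (intro exI[of _ "1 / 100000"]) auto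
qed

end
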